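(* Let $G$ be a non-nilpotent meta-$\mathfrak{Nil}$-Hamiltonian group which is polycyclic-by-finite. Then $G'$ is finite, $G$ is finite-by-polycyclic (i.e. has a finite normal subgroup with polycyclic quotient), and $\mathrm{Fit}(G)$ is nilpotent-by-finite.
   Context: A group $G$ is meta-$\mathfrak{Nil}$-Hamiltonian if every non-nilpotent subgroup of $G$ is normal in $G$. Polycyclic-by-finite means having a polycyclic normal subgroup of finite index. $\mathrm{Fit}(G)$ is the Fitting subgroup of $G$ (generated by all nilpotent normal subgroups). *)

theory Defs
  imports "HOL-Algebra.Algebra"
begin

definition commutator_subgroup :: "('a, 'b) monoid_scheme \<Rightarrow> 'a set \<Rightarrow> 'a set \<Rightarrow> 'a set" where
  "commutator_subgroup G A B =
     generate G (\<Union>a \<in> A. \<Union>b \<in> B. {a \<otimes>\<^bsub>G\<^esub> b \<otimes>\<^bsub>G\<^esub> inv\<^bsub>G\<^esub> a \<otimes>\<^bsub>G\<^esub> inv\<^bsub>G\<^esub> b})"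

(* Lower central series: gamma_1 = G (index 0 here), gamma_{i+1} = [gamma_i, G] *)
fun lower_central :: "('a, 'b) monoid_scheme \<Rightarrow> nat \<Rightarrow> 'a set" where
  "lower_central G 0 = carrier G"
| "lower_central G (Suc n) = commutator_subgroup G (lower_central G n) (carrier G)"

definition nilpotent_group :: "('a, 'b) monoid_scheme \<Rightarrow> bool" where
  "nilpotent_group G \<longleftrightarrow> group G \<and> (\<exists>n. lower_central G n = {\<one>\<^bsub>G\<^esub>})"

inductive polycyclic_seq :: "('a, 'b) monoid_scheme \<Rightarrow> 'a set \<Rightarrow> bool"
  for G where
    unity: "polycyclic_seq G {\<one>\<^bsub>G\<^esub>}"
  | extension: "\<lbrakk> polycyclic_seq G K; K \<lhd> (G\<lparr>carrier := H\<rparr>); subgroup H G;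
                  cyclic_group ((G\<lparr>carrier := H\<rparr>) Mod K) \<rbrakk> \<Longrightarrow> polycyclic_seq G H"

definition polycyclic :: "('a, 'b) monoid_scheme \<Rightarrow> bool" where
  "polycyclic G \<longleftrightarrow> group G \<and> polycyclic_seq G (carrier G)"

definition polycyclic_by_finite :: "('a, 'b) monoid_scheme \<Rightarrow> bool" where
  "polycyclic_by_finite G \<longleftrightarrow>
     (\<exists>N. N \<lhd> G \<and> polycyclic (G\<lparr>carrier := N\<rparr>) \<and> finite (rcosets\<^bsub>G\<^esub> N))"

definition finite_by_polycyclic :: "('a, 'b) monoid_scheme \<Rightarrow> bool" where
  "finite_by_polycyclic G \<longleftrightarrow> (\<exists>N. N \<lhd> G \<and> finite N \<and> polycyclic (G Mod N))"

definition nilpotent_by_finite :: "('a, 'b) monoid_scheme \<Rightarrow> bool" where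
  "nilpotent_by_finite G \<longleftrightarrow>
     (\<exists>N. N \<lhd> G \<and> nilpotent_group (G\<lparr>carrier := N\<rparr>) \<and> finite (rcosets\<^bsub>G\<^esub> N))"

definition meta_nil_hamiltonian :: "('a, 'b) monoid_scheme \<Rightarrow> bool" where
  "meta_nil_hamiltonian G \<longleftrightarrow>
     (\<forall>H. subgroup H G \<and> \<not> nilpotent_group (G\<lparr>carrier := H\<rparr>) \<longrightarrow> H \<lhd> G)"

definition fitting_subgroup :: "('a, 'b) monoid_scheme \<Rightarrow> 'a set" where
  "fitting_subgroup G = generate G (\<Union>{N. N \<lhd> G \<and> nilpotent_group (G\<lparr>carrier := N\<rparr>)})"

end

theory Submission
  imports Defs
begin

text \<open>
  Suppose that the derived subgroup is infinite. By the maximal condition, pass to a quotient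
  \<open>G\<close> all of whose proper quotients are nilpotent or have finite derived subgroup, and
  let \<open>T\<close> be its largest finite normal subgroup.

  If \<open>T = 1\<close>, there is a torsion-free abelian normal subgroup \<open>D \<noteq> 1\<close>. For \<open>g \<in> G\<close>, either some
  \<open>\<langle>g\<rangle>D\<^sup>p\<close> is nilpotent, or all of them are normal and then \<open>[D, g, g]\<close> lies in the intersection of
  all \<open>D\<^sup>p\<close>, which is trivial; so every element acts unipotently on \<open>D\<close>. Hence \<open>G\<close> acts on each
  \<open>D/D\<^sup>p\<close> as a finite p-group, and counting fixed points shows \<open>[D, G, \<dots>, G] \<le> D\<^sup>p\<close> with a number
  of commutations that does not depend on p. So \<open>D\<close> contains a central element \<open>z\<close> of infinite order,
  \<open>G'\<close> is finite modulo \<open>\<langle>z\<rangle>\<close>, and the transfer into \<open>\<langle>z\<rangle>\<close> forces \<open>G'\<close> to be central.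

  If \<open>T \<noteq> 1\<close>, then \<open>G/T\<close> is nilpotent. As \<open>G\<close> is not, either \<open>T\<close> is not nilpotent or some \<open>g\<close> does
  not act nilpotently on \<open>T\<close>. The subgroups \<open>T\<langle>gc\<rangle>\<close> with \<open>c\<close> centralizing \<open>T\<close> are then non-nilpotent, hence
  normal, which makes \<open>gc\<close> central modulo \<open>T\<close>. So \<open>G/T\<close> is centre-by-finite, and again by transfer it
  is abelian.
\<close>

subsection \<open>Commutators and the relative upper central series\<close>

text \<open>Elementwise unipotence does not suffice in the torsion-free case: the number of
  commutations that kills \<open>D\<close> may depend on \<open>g\<close>. Kolchin's theorem on
  unipotent linear groups would give a bound for the whole group; reduction modulo p replaces it, so
  that Sylow's theorem and orbit counting are enough. The bound is the size of a generating set of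
  \<open>D\<close>: D/D^p has order at most p to that size, and each fixed point costs a factor p.

  The two alternatives for proper quotients serve different cases. A quotient by a central subgroup
  cannot be nilpotent, so its derived subgroup is finite; a quotient by a finite subgroup cannot
  have finite derived subgroup, so it is nilpotent. The contradictions are that a central
  \<open>G'\<close> makes \<open>G\<close> nilpotent of class at most 2, and that an abelian
  \<open>G/T\<close> puts \<open>G'\<close> into the finite \<open>T\<close>.

  Once \<open>G'\<close> is finite, \<open>G/G'\<close> is finitely generated abelian, and the
  centre, as the centralizer of finitely many elements with finitely many conjugates each, has
  finite index. Hence every subgroup, Fit(G) included, is abelian-by-finite.\<close>

definition cmtr :: "('a, 'b) monoid_scheme \<Rightarrow> 'a \<Rightarrow> 'a \<Rightarrow> 'a" where
  "cmtr G x y = x \<otimes>\<^bsub>G\<^esub> y \<otimes>\<^bsub>G\<^esub> inv\<^bsub>G\<^esub> x \<otimes>\<^bsub>G\<^esub> inv\<^bsub>G\<^esub> y"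

text \<open>For normal \<open>N\<close> this is the full preimage in \<open>G\<close> of the n-th term of the upper central
  series of \<open>G/N\<close>; working with it keeps the element type fixed.\<close>

primrec upper_central :: "('a, 'b) monoid_scheme \<Rightarrow> 'a set \<Rightarrow> nat \<Rightarrow> 'a set" where
  "upper_central G N 0 = N"
| "upper_central G N (Suc n) = {x \<in> carrier G. \<forall>g \<in> carrier G. cmtr G x g \<in> upper_central G N n}"

context group
begin

lemma inv_cancel_left: "x \<in> carrier G \<Longrightarrow> y \<in> carrier G \<Longrightarrow> inv x \<otimes> (x \<otimes> y) = y"
  by (simp flip: m_assoc)

lemma inv_cancel_right: "x \<in> carrier G \<Longrightarrow> y \<in> carrier G \<Longrightarrow> x \<otimes> (inv x \<otimes> y) = y"
  by (simp flip: m_assoc)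

text \<open>Right-associates a word and cancels adjacent inverses, also in the middle of a word;
  this settles most identities between commutators and conjugates below.\<close>

lemmas word_simps = m_assoc inv_mult_group inv_cancel_left inv_cancel_right

lemma cmtr_closed [simp]: "x \<in> carrier G \<Longrightarrow> y \<in> carrier G \<Longrightarrow> cmtr G x y \<in> carrier G"
  by (simp add: cmtr_def)

lemma cmtr_eq_one_iff:
  assumes "x \<in> carrier G" "y \<in> carrier G"
  shows "cmtr G x y = \<one> \<longleftrightarrow> x \<otimes> y = y \<otimes> x"
proof -
  have "cmtr G x y = (x \<otimes> y) \<otimes> inv (y \<otimes> x)" using assms by (simp add: cmtr_def word_simps)
  then show ?thesis using assms by (metis m_closed inv_closed inv_equality inv_inv r_inv)
qed

lemma conj_closed: "N \<lhd> G \<Longrightarrow> x \<in> carrier G \<Longrightarrow> h \<in> N \<Longrightarrow> x \<otimes> h \<otimes> inv x \<in> N"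
  by (simp add: normal_inv_iff)

lemma normal_mem_carrier: "N \<lhd> G \<Longrightarrow> x \<in> N \<Longrightarrow> x \<in> carrier G"
  by (meson normal_imp_subgroup subgroup.mem_carrier)

lemma cmtr_mem_normal:
  assumes "N \<lhd> G" "x \<in> N" "g \<in> carrier G"
  shows "cmtr G x g \<in> N" and "cmtr G g x \<in> N"
proof -
  have s: "subgroup N G" and xc: "x \<in> carrier G"
    using assms normal_imp_subgroup normal_mem_carrier by auto
  have "cmtr G x g = x \<otimes> (g \<otimes> inv x \<otimes> inv g)" using xc assms by (simp add: cmtr_def word_simps)
  then show "cmtr G x g \<in> N"
    using assms s by (simp add: conj_closed subgroup.m_closed subgroup.m_inv_closed)
  have "cmtr G g x = (g \<otimes> x \<otimes> inv g) \<otimes> inv x" using xc assms by (simp add: cmtr_def word_simps)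
  then show "cmtr G g x \<in> N"
    using assms s by (simp add: conj_closed subgroup.m_closed subgroup.m_inv_closed)
qed

text \<open>For \<open>M\<close> inside \<open>T\<close> this is the full preimage of the centre of
  T/M. With \<open>T = carrier G\<close> it is one step of the upper central series; general
  \<open>T\<close> is for sections of a finite normal subgroup. Closure comes from expanding
  [x^-1,g], [xy,g] and [hxh^-1,g] into conjugates of commutators with \<open>x\<close> and
  \<open>y\<close>.\<close>

lemma relative_center_normal:
  assumes M: "M \<lhd> G" and T: "T \<lhd> G"
  shows "{x \<in> T. \<forall>g \<in> T. cmtr G x g \<in> M} \<lhd> G" (is "?Z \<lhd> G")
proof -
  have s: "subgroup M G" and sT: "subgroup T G" using assms normal_imp_subgroup by auto
  have Tc: "x \<in> carrier G" if "x \<in> T" for x using that normal_mem_carrier[OF T] by auto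
  have sub: "subgroup ?Z G"
  proof (rule subgroupI)
    show "?Z \<subseteq> carrier G" using Tc by auto
    show "?Z \<noteq> {}"
      using subgroup.one_closed[OF s] subgroup.one_closed[OF sT] Tc
      by (auto simp: cmtr_def intro!: exI[of _ \<one>])
    fix x assume x: "x \<in> ?Z"
    have "cmtr G (inv x) g = inv x \<otimes> inv (cmtr G x g) \<otimes> inv (inv x)" if "g \<in> T" for g
      using x Tc that by (simp add: cmtr_def word_simps)
    then show "inv x \<in> ?Z"
      using x Tc conj_closed[OF M, of "inv x"] subgroup.m_inv_closed[OF s] subgroup.m_inv_closed[OF sT]
      by simp
    fix y assume y: "y \<in> ?Z"
    have "cmtr G (x \<otimes> y) g = (x \<otimes> cmtr G y g \<otimes> inv x) \<otimes> cmtr G x g" if "g \<in> T" for g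
      using x y Tc that by (simp add: cmtr_def word_simps)
    then show "x \<otimes> y \<in> ?Z"
      using x y Tc conj_closed[OF M, of x] subgroup.m_closed[OF s] subgroup.m_closed[OF sT] by simp
  qed
  show ?thesis
  proof (subst normal_inv_iff, intro conjI sub ballI)
    fix h x assume h: "h \<in> carrier G" and x: "x \<in> ?Z"
    have "cmtr G (h \<otimes> x \<otimes> inv h) g = h \<otimes> cmtr G x (inv h \<otimes> g \<otimes> h) \<otimes> inv h"
      if "g \<in> T" for g
      using h x Tc that by (simp add: cmtr_def word_simps)
    moreover have "inv h \<otimes> g \<otimes> h \<in> T" if "g \<in> T" for g
      using conj_closed[OF T, of "inv h" g] h that by simp
    ultimately show "h \<otimes> x \<otimes> inv h \<in> ?Z"
      using h x conj_closed[OF M h] conj_closed[OF T h] by auto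
  qed
qed

lemma upper_central_normal: "N \<lhd> G \<Longrightarrow> upper_central G N n \<lhd> G"
  by (induction n) (use relative_center_normal[OF _ normal_self] in auto)

lemma upper_central_mono: "N \<subseteq> M \<Longrightarrow> upper_central G N n \<subseteq> upper_central G M n"
  by (induction n) auto

lemma upper_central_add: "upper_central G (upper_central G N m) n = upper_central G N (m + n)"
  by (induction n) auto

lemma upper_central_le_Suc: "N \<lhd> G \<Longrightarrow> upper_central G N n \<subseteq> upper_central G N (Suc n)"
  using upper_central_normal[of N n] cmtr_mem_normal normal_mem_carrier by fastforce

lemma upper_central_incseq:
  assumes "N \<lhd> G" "m \<le> n"
  shows "upper_central G N m \<subseteq> upper_central G N n"
  using lift_Suc_mono_le[of "upper_central G N"] upper_central_le_Suc assms by blast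

lemma upper_central_subset_carrier: "N \<subseteq> carrier G \<Longrightarrow> upper_central G N n \<subseteq> carrier G"
  by (cases n) auto

lemma lower_central_subset: "lower_central G n \<subseteq> carrier G"
proof (induction n)
  case (Suc n)
  then show ?case
    unfolding lower_central.simps commutator_subgroup_def by (intro generate_incl) auto
qed auto

section \<open>Nilpotency in terms of the upper central series\<close>

lemma nilpotent_iff_upper_central:
  "nilpotent_group G \<longleftrightarrow> (\<exists>n. upper_central G {\<one>} n = carrier G)"
proof
  assume "nilpotent_group G"
  then obtain n where n: "lower_central G n = {\<one>}" by (auto simp: nilpotent_group_def)
  \<comment> \<open>The lower series is followed backwards from its trivial term \<open>n\<close>
    while the upper series ascends.\<close>
  have "j \<le> n \<Longrightarrow> lower_central G (n - j) \<subseteq> upper_central G {\<one>} j" for j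
  proof (induction j)
    case (Suc j)
    have eq: "n - j = Suc (n - Suc j)" using Suc.prems by simp
    show ?case
    proof
      fix x assume x: "x \<in> lower_central G (n - Suc j)"
      have "cmtr G x g \<in> lower_central G (n - j)" if "g \<in> carrier G" for g
        unfolding eq lower_central.simps commutator_subgroup_def
        by (rule generate.incl) (use x that in \<open>auto simp: cmtr_def\<close>)
      then show "x \<in> upper_central G {\<one>} (Suc j)"
        using x Suc lower_central_subset by fastforce
    qed
  qed (use n in auto)
  from this[of n] show "\<exists>n. upper_central G {\<one>} n = carrier G"
    using upper_central_subset_carrier[of "{\<one>}" n] by auto
next
  assume "\<exists>n. upper_central G {\<one>} n = carrier G"
  then obtain n where n: "upper_central G {\<one>} n = carrier G" by auto
  \<comment> \<open>The mirror image: the lower series descends inside the upper one, whose term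
    \<open>n\<close> is everything.\<close>
  have "j \<le> n \<Longrightarrow> lower_central G j \<subseteq> upper_central G {\<one>} (n - j)" for j
  proof (induction j)
    case (Suc j)
    have eq: "n - j = Suc (n - Suc j)" using Suc.prems by simp
    have "subgroup (upper_central G {\<one>} (n - Suc j)) G"
      using upper_central_normal normal_imp_subgroup one_is_normal by auto
    moreover have "\<And>a b. a \<in> lower_central G j \<Longrightarrow> b \<in> carrier G \<Longrightarrow>
        cmtr G a b \<in> upper_central G {\<one>} (n - Suc j)"
      using Suc eq by fastforce
    ultimately show ?case
      unfolding lower_central.simps commutator_subgroup_def
      by (intro generate_subgroup_incl) (auto simp: cmtr_def)
  qed (use n in auto)
  from this[of n] have "lower_central G n \<subseteq> {\<one>}" by simp
  moreover have "\<one> \<in> lower_central G n"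
    by (cases n) (auto simp: commutator_subgroup_def intro: generate.one)
  ultimately show "nilpotent_group G"
    unfolding nilpotent_group_def using is_group by auto
qed

lemma cmtr_consistent:
  "subgroup H G \<Longrightarrow> x \<in> H \<Longrightarrow> y \<in> H \<Longrightarrow> cmtr (G\<lparr>carrier := H\<rparr>) x y = cmtr G x y"
  by (simp add: cmtr_def m_inv_consistent)

text \<open>The upper central terms of \<open>K\<close> meet \<open>H\<close> inside those of
  \<open>H\<close>, because for \<open>H\<close> fewer commutators are tested.\<close>

lemma nilpotent_subgroup:
  assumes "subgroup H G" "subgroup K G" "H \<subseteq> K" "nilpotent_group (G\<lparr>carrier := K\<rparr>)"
  shows "nilpotent_group (G\<lparr>carrier := H\<rparr>)"
proof -
  have gH: "group (G\<lparr>carrier := H\<rparr>)" and gK: "group (G\<lparr>carrier := K\<rparr>)"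
    using assms subgroup_imp_group by auto
  obtain n where n: "upper_central (G\<lparr>carrier := K\<rparr>) {\<one>} n = K"
    using group.nilpotent_iff_upper_central[OF gK] assms(4) by auto
  have "upper_central (G\<lparr>carrier := K\<rparr>) {\<one>} n \<inter> H \<subseteq> upper_central (G\<lparr>carrier := H\<rparr>) {\<one>} n" for n
  proof (induction n)
    case (Suc n)
    have "cmtr (G\<lparr>carrier := H\<rparr>) x g \<in> H" if "x \<in> H" "g \<in> H" for x g
      using group.cmtr_closed[OF gH, of x g] that by simp
    then show ?case
      using Suc assms by (auto simp: cmtr_consistent subset_iff)
  qed auto
  from this[of n] n have "upper_central (G\<lparr>carrier := H\<rparr>) {\<one>} n = H"
    using assms(3) group.upper_central_subset_carrier[OF gH, of "{\<one>}" n] assms(1)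
    by (auto dest: subgroup.one_closed)
  then show ?thesis using group.nilpotent_iff_upper_central[OF gH] by auto
qed

end

lemma (in group_hom) cmtr_img:
  "x \<in> carrier G \<Longrightarrow> y \<in> carrier G \<Longrightarrow> h (cmtr G x y) = cmtr H (h x) (h y)"
  by (simp add: cmtr_def)

text \<open>By surjectivity every element of \<open>H\<close> against which a commutator is tested
  has a preimage.\<close>

lemma (in group_hom) upper_central_img:
  assumes surj: "h ` carrier G = carrier H" and "h ` N \<subseteq> M" "N \<subseteq> carrier G"
  shows "h ` upper_central G N n \<subseteq> upper_central H M n"
proof (induction n)
  case (Suc n)
  have "cmtr H (h x) g \<in> upper_central H M n"
    if x: "x \<in> upper_central G N (Suc n)" and "g \<in> carrier H" for x g
  proof -
    obtain g' where g': "g' \<in> carrier G" "g = h g'" using surj \<open>g \<in> carrier H\<close> by auto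
    then have "cmtr G x g' \<in> upper_central G N n" using x by auto
    then show ?thesis using g' x Suc by (auto simp: cmtr_img[symmetric])
  qed
  then show ?case by auto
qed (use assms in auto)

lemma (in group_hom) nilpotent_img:
  assumes surj: "h ` carrier G = carrier H" and "nilpotent_group G"
  shows "nilpotent_group H"
proof -
  obtain n where "upper_central G {\<one>\<^bsub>G\<^esub>} n = carrier G"
    using assms G.nilpotent_iff_upper_central by auto
  then have "carrier H \<subseteq> upper_central H {\<one>\<^bsub>H\<^esub>} n"
    using upper_central_img[OF surj, of "{\<one>\<^bsub>G\<^esub>}" "{\<one>\<^bsub>H\<^esub>}" n] surj by auto
  then show ?thesis
    using H.nilpotent_iff_upper_central H.upper_central_subset_carrier[of "{\<one>\<^bsub>H\<^esub>}" n] by auto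
qed

subsection \<open>Transfer into a central subgroup of finite index\<close>

context group
begin

text \<open>\<open>V\<close> is the transfer, the product over all right cosets \<open>K\<close> of
  the factors \<open>c K x\<close>; the order is immaterial as \<open>Z\<close> is abelian. The
  factors satisfy the cocycle identity \<open>c_mult\<close>, and right multiplication permutes the
  cosets, so \<open>V\<close> is multiplicative. A central \<open>z\<close> fixes every coset, so
  each factor is \<open>z\<close> and \<open>n\<close> is the index of \<open>Z\<close>.\<close>

lemma central_transfer:
  assumes Z: "subgroup Z G" and cent: "\<And>z g. z \<in> Z \<Longrightarrow> g \<in> carrier G \<Longrightarrow> z \<otimes> g = g \<otimes> z"
    and fin: "finite (rcosets Z)"
  obtains V n where "V \<in> hom G (G\<lparr>carrier := Z\<rparr>)" "0 < (n::nat)" "\<forall>z \<in> Z. V z = z [^] n"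
proof -
  let ?A = "G\<lparr>carrier := Z\<rparr>"
  define rep where "rep K = (SOME x. x \<in> K)" for K :: "'a set"
  define c where "c K x = rep K \<otimes> x \<otimes> inv (rep (K #> x))" for K x
  have Zc: "Z \<subseteq> carrier G" using Z subgroup.subset by auto
  interpret A: group ?A using Z subgroup_imp_group by auto
  interpret A: comm_group ?A
    by (rule A.group_comm_groupI) (use cent Zc in auto)
  have rep: "rep K \<in> K" if "K \<in> rcosets Z" for K
    unfolding rep_def using subgroup.rcosets_non_empty[OF Z that] by (simp add: some_in_eq)
  have repc: "rep K \<in> carrier G" if "K \<in> rcosets Z" for K
    using rep[OF that] subgroup.rcosets_carrier[OF Z is_group that] by auto
  have cosx: "K #> x \<in> rcosets Z" if "K \<in> rcosets Z" "x \<in> carrier G" for K x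
    using that Zc by (auto simp: RCOSETS_def coset_mult_assoc)
  have cZ: "c K x \<in> Z" if K: "K \<in> rcosets Z" and x: "x \<in> carrier G" for K x
  proof -
    have "rep K \<otimes> x \<in> K #> x" using rep[OF K] by (auto simp: r_coset_def)
    then show ?thesis
      unfolding c_def using diff_neutralizes[OF Z cosx[OF K x]] rep[OF cosx[OF K x]] by auto
  qed
  have c_mult: "c K (x \<otimes> y) = c K x \<otimes> c (K #> x) y"
    if K: "K \<in> rcosets Z" and x: "x \<in> carrier G" and y: "y \<in> carrier G" for K x y
  proof -
    have "K #> x #> y = K #> (x \<otimes> y)"
      using coset_mult_assoc subgroup.rcosets_carrier[OF Z is_group K] x y by auto
    then show ?thesis
      unfolding c_def
      using repc[OF K] repc[OF cosx[OF K x]] repc[OF cosx[OF cosx[OF K x] y]] x y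
      by (simp add: word_simps)
  qed
  define V where "V x = finprod ?A (\<lambda>K. c K x) (rcosets Z)" for x
  have Vc: "V x \<in> Z" if "x \<in> carrier G" for x
    using A.finprod_closed[of "\<lambda>K. c K x" "rcosets Z"] cZ[OF _ that] unfolding V_def
    by (simp add: Pi_iff)
  have inj: "inj_on (\<lambda>K. K #> x) (rcosets Z)" if x: "x \<in> carrier G" for x
  proof (rule inj_onI)
    fix K L assume K: "K \<in> rcosets Z" and L: "L \<in> rcosets Z" and eq: "K #> x = L #> x"
    have "K #> x #> inv x = K" "L #> x #> inv x = L"
      using x subgroup.rcosets_carrier[OF Z is_group] K L by (auto simp: coset_mult_assoc)
    then show "K = L" using eq by metis
  qed
  have img: "(\<lambda>K. K #> x) ` (rcosets Z) = rcosets Z" if x: "x \<in> carrier G" for x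
    using endo_inj_surj[OF fin _ inj[OF x]] cosx x by auto
  have V_mult: "V (x \<otimes> y) = V x \<otimes> V y" if x: "x \<in> carrier G" and y: "y \<in> carrier G" for x y
  proof -
    have "V (x \<otimes> y) = finprod ?A (\<lambda>K. c K x \<otimes>\<^bsub>?A\<^esub> c (K #> x) y) (rcosets Z)"
      unfolding V_def by (rule A.finprod_cong) (use c_mult x y cZ cosx subgroup.m_closed[OF Z] in \<open>auto simp: simp_implies_def\<close>)
    also have "\<dots> = V x \<otimes>\<^bsub>?A\<^esub> finprod ?A (\<lambda>K. c (K #> x) y) (rcosets Z)"
      unfolding V_def by (rule A.finprod_multf) (use cZ cosx x y in auto)
    also have "finprod ?A (\<lambda>K. c (K #> x) y) (rcosets Z) = V y"
      unfolding V_def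
      using A.finprod_reindex[of "\<lambda>K. c K y" "\<lambda>K. K #> x" "rcosets Z"] inj[OF x] img[OF x] cZ[OF _ y]
      by auto
    finally show ?thesis by simp
  qed
  have hom: "V \<in> hom G ?A" using Vc V_mult by (auto simp: hom_def)
  have pos: "0 < card (rcosets Z)"
    using fin subgroup.subgroup_in_rcosets[OF Z is_group] by (auto simp: card_gt_0_iff)
  have "V z = z [^] card (rcosets Z)" if z: "z \<in> Z" for z
  proof -
    have "c K z = z" if K: "K \<in> rcosets Z" for K
    proof -
      obtain r where r: "r \<in> carrier G" "K = Z #> r" using K by (auto simp: RCOSETS_def)
      have "K #> z = Z #> (z \<otimes> r)"
        using r z Zc cent[OF z] by (auto simp: coset_mult_assoc subset_iff)
      also have "\<dots> = K" using r z Zc coset_mult_assoc[of Z z r] coset_join2[OF _ Z z] by auto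
      finally have "K #> z = K" .
      then show ?thesis
        unfolding c_def using repc[OF K] z Zc cent[OF z] by (auto simp: word_simps subset_iff)
    qed
    then have "V z = finprod ?A (\<lambda>K. z) (rcosets Z)"
      unfolding V_def by (intro A.finprod_cong) (use z in \<open>auto simp: simp_implies_def\<close>)
    also have "\<dots> = z [^]\<^bsub>?A\<^esub> card (rcosets Z)"
      using A.finprod_const[of z] z by auto
    finally show ?thesis by (simp flip: nat_pow_consistent)
  qed
  with hom pos that show thesis by blast
qed

lemma conj_nat_pow:
  assumes "g \<in> carrier G" "x \<in> carrier G"
  shows "(g \<otimes> x \<otimes> inv g) [^] (n::nat) = g \<otimes> x [^] n \<otimes> inv g"
  by (induction n) (use assms in \<open>auto simp: word_simps\<close>)

lemma central_imp_normal:
  assumes "subgroup H G" "\<And>h g. h \<in> H \<Longrightarrow> g \<in> carrier G \<Longrightarrow> h \<otimes> g = g \<otimes> h"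
  shows "H \<lhd> G"
proof (subst normal_inv_iff, intro conjI ballI assms(1))
  fix g h assume "g \<in> carrier G" "h \<in> H"
  then have "g \<otimes> h \<otimes> inv g = h"
    using assms(2)[of h g, symmetric] subgroup.mem_carrier[OF assms(1)] by (simp add: word_simps)
  then show "g \<otimes> h \<otimes> inv g \<in> H" using \<open>h \<in> H\<close> by simp
qed

lemma finite_generate_singleton_iff:
  "x \<in> carrier G \<Longrightarrow> finite (generate G {x}) \<longleftrightarrow> (\<exists>n::nat. n \<noteq> 0 \<and> x [^] n = \<one>)"
  using finite_cyclic_subgroup[of x] by (simp add: carrier_subgroup_generated)

lemma central_generate_singleton:
  assumes "z \<in> carrier G" "\<And>g. g \<in> carrier G \<Longrightarrow> z \<otimes> g = g \<otimes> z"
    and "h \<in> generate G {z}" "g \<in> carrier G"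
  shows "h \<otimes> g = g \<otimes> h"
  using assms(3)
proof (induction rule: generate.induct)
  case (inv h)
  then have "h = z" by simp
  then show ?case using assms(1,2,4) by (metis inv_closed inv_solve_left inv_solve_right' m_assoc m_closed)
next
  case (eng h1 h2)
  then have "h1 \<in> carrier G" "h2 \<in> carrier G"
    using generate_in_carrier[of "{z}"] assms(1) by auto
  then show ?case using eng assms(4) by (metis m_assoc)
qed (use assms in auto)

text \<open>The kernel of the transfer \<open>V\<close> from \<open>P\<close> to \<open>Z\<close>
  turns out to be finite and normal in \<open>G\<close>, hence trivial. Then
  \<open>x [^] n = V x\<close> on \<open>P\<close>, so that n-th powers are central; conjugates have
  equal n-th powers and the injectivity of \<open>V\<close> makes them equal.\<close>

lemma virtually_central_normal_imp_central:
  assumes P: "P \<lhd> G" and Z: "subgroup Z G" "Z \<subseteq> P"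
    and cent: "\<And>z g. z \<in> Z \<Longrightarrow> g \<in> carrier G \<Longrightarrow> z \<otimes> g = g \<otimes> z"
    and fin: "finite (rcosets\<^bsub>G\<lparr>carrier := P\<rparr>\<^esub> Z)"
    and nofin: "\<And>F. F \<lhd> G \<Longrightarrow> finite F \<Longrightarrow> F = {\<one>}"
    and p: "p \<in> P" and g: "g \<in> carrier G"
  shows "p \<otimes> g = g \<otimes> p"
proof -
  let ?P = "G\<lparr>carrier := P\<rparr>"
  have sP: "subgroup P G" using P normal_imp_subgroup by auto
  have Pc: "x \<in> carrier G" if "x \<in> P" for x using that normal_mem_carrier[OF P] by auto
  interpret P: group ?P using sP subgroup_imp_group by auto
  have ZP: "subgroup Z ?P" using Z sP subgroup_incl by auto
  have centP: "z \<otimes>\<^bsub>?P\<^esub> g = g \<otimes>\<^bsub>?P\<^esub> z" if "z \<in> Z" "g \<in> carrier ?P" for z g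
    using cent Pc that by simp
  obtain V n where hom: "V \<in> hom ?P (?P\<lparr>carrier := Z\<rparr>)" and n: "0 < (n::nat)"
    and VZ: "\<forall>z \<in> Z. V z = z [^]\<^bsub>?P\<^esub> n"
    by (rule P.central_transfer[OF ZP centP fin]) blast
  have VZ: "V z = z [^] n" if "z \<in> Z" for z
    using VZ that by (simp flip: nat_pow_consistent)
  have Vc: "V x \<in> Z" if "x \<in> P" for x using hom that by (auto simp: hom_def)
  have Vm: "V (x \<otimes> y) = V x \<otimes> V y" if "x \<in> P" "y \<in> P" for x y
    using hom that by (auto simp: hom_def)
  have oneP: "\<one> \<in> P" using sP by (simp add: subgroup.one_closed)
  have Zc: "z \<in> carrier G" if "z \<in> Z" for z using that Z Pc by auto
  have V1: "V \<one> = \<one>" using VZ[of \<one>] Z by (simp add: subgroup.one_closed)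
  have Vi: "V (inv x) = inv (V x)" if "x \<in> P" for x
  proof -
    have "V (inv x) \<otimes> V x = \<one>"
      using Vm[of "inv x" x] that sP V1 Pc by (simp add: subgroup.m_inv_closed)
    then show ?thesis
      using Vc[of "inv x"] Vc[OF that] Zc that sP by (simp add: inv_equality subgroup.m_inv_closed)
  qed
  have Ppow: "x [^] (k::nat) \<in> P" if "x \<in> P" for x k
    using that oneP sP by (induction k) (auto simp: subgroup.m_closed)
  have Vp: "V (x [^] (k::nat)) = V x [^] k" if "x \<in> P" for x k
    using that V1 Ppow by (induction k) (auto simp: Vm)
  \<comment> \<open>A torsion element of the central \<open>Z\<close> generates a finite normal
    subgroup of \<open>G\<close>.\<close>
  have Ztf: "z = \<one>" if z: "z \<in> Z" and "m \<noteq> 0" "z [^] (m::nat) = \<one>" for z m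
  proof -
    have "finite (generate G {z})" using finite_generate_singleton_iff Zc[OF z] that by auto
    moreover have "generate G {z} \<lhd> G"
    proof (rule central_imp_normal)
      show "subgroup (generate G {z}) G" using generate_is_subgroup[of "{z}"] Zc[OF z] by simp
      show "h \<otimes> g = g \<otimes> h" if "h \<in> generate G {z}" "g \<in> carrier G" for h g
        using central_generate_singleton[OF Zc[OF z] cent[OF z] that] by simp
    qed
    ultimately have "generate G {z} = {\<one>}" using nofin by auto
    then show ?thesis using generate.incl[of z "{z}" G] by auto
  qed
  define K where "K = {x \<in> P. V x = \<one>}"
  have sK: "subgroup K G"
    by (rule subgroupI)
      (use Pc oneP V1 sP Vm Vi in \<open>auto simp: K_def subgroup.m_closed subgroup.m_inv_closed\<close>)
  \<comment> \<open>\<open>K\<close> meets \<open>Z\<close> trivially, because \<open>V\<close> is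
    the n-th power map on the torsion-free \<open>Z\<close>; so \<open>K\<close> embeds into the
    cosets of \<open>Z\<close>.\<close>
  have "inj_on (\<lambda>x. Z #> x) K"
  proof (rule inj_onI)
    fix x y assume x: "x \<in> K" and y: "y \<in> K" and eq: "Z #> x = Z #> y"
    have "x \<in> Z #> y" using eq rcos_self[OF _ Z(1)] x Pc by (auto simp: K_def)
    then obtain z where z: "z \<in> Z" "x = z \<otimes> y" by (auto simp: r_coset_def)
    then have "z [^] n = \<one>"
      using x y Vm[of z y] VZ[of z] Z(2) Zc by (auto simp: K_def)
    then have "z = \<one>" using Ztf[OF z(1)] n by auto
    then show "x = y" using z y Pc by (auto simp: K_def)
  qed
  moreover have "(\<lambda>x. Z #> x) ` K \<subseteq> rcosets\<^bsub>?P\<^esub> Z"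
    by (auto simp: RCOSETS_def K_def)
  ultimately have finK: "finite K" using fin finite_subset finite_imageD by blast
  \<comment> \<open>As the set of torsion elements of \<open>P\<close> the kernel is visibly
    invariant under conjugation in all of \<open>G\<close>; this is not apparent from
    \<open>V\<close>, which is built inside \<open>P\<close> from chosen representatives.\<close>
  have K_iff: "x \<in> K \<longleftrightarrow> x \<in> P \<and> (\<exists>m::nat. m \<noteq> 0 \<and> x [^] m = \<one>)" for x
  proof
    assume x: "x \<in> K"
    then have "generate G {x} \<subseteq> K" using sK by (intro generate_subgroup_incl) auto
    then have "finite (generate G {x})" using finK finite_subset by auto
    then show "x \<in> P \<and> (\<exists>m::nat. m \<noteq> 0 \<and> x [^] m = \<one>)"
      using x finite_generate_singleton_iff Pc by (auto simp: K_def)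
  next
    assume "x \<in> P \<and> (\<exists>m::nat. m \<noteq> 0 \<and> x [^] m = \<one>)"
    then obtain m where m: "x \<in> P" "m \<noteq> (0::nat)" "x [^] m = \<one>" by auto
    then show "x \<in> K" using Vp[of x m] V1 Ztf[of "V x" m] Vc by (auto simp: K_def)
  qed
  have "K \<lhd> G"
  proof (subst normal_inv_iff, intro conjI ballI sK)
    fix h x assume h: "h \<in> carrier G" and "x \<in> K"
    then obtain m where m: "x \<in> P" "m \<noteq> (0::nat)" "x [^] m = \<one>" using K_iff by auto
    then have "(h \<otimes> x \<otimes> inv h) [^] m = \<one>" using h Pc by (simp add: conj_nat_pow)
    then show "h \<otimes> x \<otimes> inv h \<in> K" using K_iff m conj_closed[OF P h] by auto
  qed
  then have K1: "K = {\<one>}" using nofin finK by auto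
  have eqI: "x = y" if x: "x \<in> P" and y: "y \<in> P" and "V x = V y" for x y
  proof -
    have "x \<otimes> inv y \<in> P" using x y sP by (simp add: subgroup.m_closed subgroup.m_inv_closed)
    moreover have "V (x \<otimes> inv y) = \<one>"
      using that Vm Vi sP Zc[OF Vc] by (simp add: subgroup.m_inv_closed)
    ultimately have "x \<otimes> inv y = \<one>" using K1 by (auto simp: K_def)
    then show ?thesis using x y Pc by (metis inv_equality inv_inv inv_closed)
  qed
  \<comment> \<open>Both sides have the image \<open>V x [^] n\<close> under the injective
    \<open>V\<close>.\<close>
  have pow: "x [^] n = V x" if x: "x \<in> P" for x
    by (rule eqI) (use x Vp VZ Vc Ppow Z(2) in auto)
  let ?q = "g \<otimes> p \<otimes> inv g"
  have q: "?q \<in> P" using conj_closed[OF P g p] .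
  have "V ?q = g \<otimes> V p \<otimes> inv g"
    using pow[OF q] pow[OF p] conj_nat_pow[OF g] Pc[OF p] by simp
  also have "\<dots> = V p" using cent[OF Vc[OF p] g, symmetric] Zc[OF Vc[OF p]] g by (simp add: word_simps)
  finally have "?q = p" using eqI q p by auto
  then show ?thesis using g Pc[OF p] by (metis inv_solve_right' m_closed)
qed

end

subsection \<open>Fixed points of unipotent actions on finite abelian p-sections\<close>

text \<open>HOL-Algebra hides \<open>prime\<close> on numbers behind its own constant of that name.\<close>

abbreviation nat_prime :: "nat \<Rightarrow> bool" where "nat_prime \<equiv> Factorial_Ring.prime"

text \<open>Behind it stands (1 - \<phi>)^(p^k) = 1 - \<phi>^(p^k) in characteristic p. Induction on
  \<open>k\<close> proves the consequence for a single vector without forming the endomorphism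
  ring.\<close>

lemma (in comm_group) unipotent_hom_pow_prime:
  assumes phi: "\<phi> \<in> hom G G" and exp: "\<And>v. v \<in> carrier G \<Longrightarrow> v [^] p = \<one>" and "nat_prime p"
    and "v \<in> carrier G" "((\<lambda>v. v \<otimes> inv (\<phi> v)) ^^ k) v = \<one>"
  shows "(\<phi> ^^ (p ^ k)) v = v"
  using assms(4,5)
proof (induction k arbitrary: v)
  case 0
  interpret group_hom G G \<phi> using phi by (simp add: group_hom_def group_hom_axioms_def is_group)
  from 0 show ?case by simp
next
  case (Suc k)
  interpret group_hom G G \<phi> using phi by (simp add: group_hom_def group_hom_axioms_def is_group)
  note v = \<open>v \<in> carrier G\<close>
  define \<psi> where "\<psi> = \<phi> ^^ (p ^ k)"
  have pw: "(\<phi> ^^ n) \<in> hom G G" for n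
    by (induction n) (use phi in \<open>auto simp: hom_def Pi_iff\<close>)
  interpret psi: group_hom G G \<psi>
    using pw[of "p ^ k"] by (simp add: group_hom_def group_hom_axioms_def is_group \<psi>_def)
  have comm: "\<phi> (\<psi> u) = \<psi> (\<phi> u)" for u unfolding \<psi>_def by (simp add: funpow_swap1)
  have "((\<lambda>v. v \<otimes> inv (\<phi> v)) ^^ k) (v \<otimes> inv (\<phi> v)) = \<one>"
    using Suc.prems(2) by (simp only: funpow_Suc_right comp_apply)
  then have "\<psi> (v \<otimes> inv (\<phi> v)) = v \<otimes> inv (\<phi> v)"
    using Suc.IH[of "v \<otimes> inv (\<phi> v)"] v by (simp add: \<psi>_def)
  then have eq: "\<psi> v \<otimes> inv (\<psi> (\<phi> v)) = v \<otimes> inv (\<phi> v)" using v by simp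
  \<comment> \<open>By the induction hypothesis \<open>\<psi>\<close> fixes the displacement of
    \<open>v\<close> under \<open>\<phi>\<close>. The two maps commute, so \<open>\<phi>\<close>
    fixes the displacement \<open>w\<close> of \<open>v\<close> under \<open>\<psi>\<close>.\<close>
  define w where "w = v \<otimes> inv (\<psi> v)"
  have w: "w \<in> carrier G" using v by (simp add: w_def)
  have "\<phi> w = \<phi> v \<otimes> inv (\<psi> (\<phi> v))" using v by (simp add: w_def comm)
  also have "\<dots> = \<phi> v \<otimes> inv (\<psi> v) \<otimes> (\<psi> v \<otimes> inv (\<psi> (\<phi> v)))"
    using v by (simp add: word_simps)
  also have "\<dots> = \<phi> v \<otimes> inv (\<psi> v) \<otimes> (v \<otimes> inv (\<phi> v))" by (simp only: eq)
  also have "\<dots> = w \<otimes> (\<phi> v \<otimes> inv (\<phi> v))" using v unfolding w_def by (simp add: m_ac inv_cancel_right)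
  finally have phw: "\<phi> w = w" using v w by simp
  have "(\<phi> ^^ n) w = w" for n by (induction n) (use phw in auto)
  then have psw: "\<psi> w = w" by (simp add: \<psi>_def)
  have psv: "\<psi> v = inv w \<otimes> v" using v by (simp add: w_def word_simps)
  \<comment> \<open>Each application of \<open>\<psi>\<close> divides by the same \<open>w\<close>,
    so \<open>p\<close> of them divide by \<open>w [^] p = \<one>\<close>.\<close>
  have "(\<psi> ^^ j) v = inv (w [^] j) \<otimes> v" for j :: nat
  proof (induction j)
    case (Suc j)
    have wj: "w [^] j \<in> carrier G" using w by simp
    have "\<psi> (w [^] j) = w [^] j" using psw w psi.hom_nat_pow by simp
    then have "(\<psi> ^^ Suc j) v = inv (w [^] j) \<otimes> (inv w \<otimes> v)"
      using Suc v w wj psv by simp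
    then show ?case using v w wj by (simp add: word_simps m_ac)
  qed (use v in simp)
  from this[of p] have "(\<psi> ^^ p) v = v" using exp[OF w] v by simp
  then show ?case unfolding \<psi>_def by (simp add: funpow_mult mult.commute)
qed

lemma (in group) prime_power_order:
  assumes fin: "finite (carrier G)" and p: "nat_prime p"
    and el: "\<And>x. x \<in> carrier G \<Longrightarrow> \<exists>k. x [^] (p ^ k :: nat) = \<one>"
  shows "\<exists>a. order G = p ^ a"
proof (rule ccontr)
  assume np: "\<not> ?thesis"
  have pos: "order G > 0" using fin by (simp add: order_gt_0_iff_finite)
  with p obtain y where y: "order G = p ^ multiplicity p (order G) * y" "\<not> p dvd y"
    using multiplicity_decompose'[of "order G" p] p by (metis not_prime_unit less_numeral_extra(3))
  from np have "y \<noteq> 1" using y(1) by (metis mult.right_neutral)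
  then obtain q where "nat_prime q" "q dvd y" using prime_factor_nat by blast
  then have q: "nat_prime q" "q dvd order G" "q \<noteq> p" using y by (simp, metis dvd_mult, blast)
  \<comment> \<open>\<open>sylow_thm\<close> does not ask that \<open>m\<close> be prime to
    \<open>q\<close>, so with exponent 1 it yields Cauchy's theorem.\<close>
  then obtain m where "order G = q ^ 1 * m" by auto
  then obtain H where H: "subgroup H G" "card H = q"
    using sylow_thm[OF q(1) is_group _ fin, of 1 m] by auto
  have "finite H" using fin H(1) subgroup.subset finite_subset by blast
  have "\<not> H \<subseteq> {\<one>}"
    using H(2) q(1) card_mono[of "{\<one>}" H] prime_gt_1_nat[OF q(1)] by auto
  then obtain x where x: "x \<in> H" "x \<noteq> \<one>" by auto
  have xc: "x \<in> carrier G" using subgroup.mem_carrier[OF H(1) x(1)] .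
  interpret H: group "G\<lparr>carrier := H\<rparr>" using H(1) subgroup_imp_group by auto
  have "x [^]\<^bsub>G\<lparr>carrier := H\<rparr>\<^esub> order (G\<lparr>carrier := H\<rparr>) = \<one>"
    using H.pow_order_eq_1[of x] x by simp
  then have "x [^] q = \<one>" using H(2) by (simp add: order_def flip: nat_pow_consistent)
  then have "ord x dvd q" using pow_eq_id xc by auto
  moreover obtain k where "x [^] (p ^ k) = \<one>" using el[OF xc] by auto
  then have "ord x dvd p ^ k" using pow_eq_id xc by auto
  moreover have "coprime q (p ^ k)" using q p by (simp add: primes_coprime)
  ultimately have "ord x = 1" using coprime_common_divisor_nat by blast
  then show False using x xc ord_eq_1 by auto
qed

text \<open>Orbits of a p-group that are not singletons have size divisible by p; with
  \<open>x0\<close> as the only fixed point, \<open>card E\<close> would be 1 modulo p.\<close>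

lemma (in group_action) prime_power_fixed_point:
  assumes "finite E" "nat_prime p" "order G = p ^ a" "p dvd card E"
    and x0: "x0 \<in> E" "\<And>g. g \<in> carrier G \<Longrightarrow> \<phi> g x0 = x0"
  shows "\<exists>y \<in> E. y \<noteq> x0 \<and> (\<forall>g \<in> carrier G. \<phi> g y = y)"
proof (rule ccontr)
  assume no: "\<not> ?thesis"
  let ?O = "orbits G E \<phi>"
  interpret gh: group_hom G "BijGroup E" \<phi> by (rule group_hom)
  have orb0: "orbit G \<phi> x0 = {x0}"
    using x0(2)[symmetric] x0(2) gh.G.one_closed unfolding orbit_def by blast
  have x0O: "{x0} \<in> ?O" unfolding orbits_def using x0 orb0 by auto
  have dvd: "p dvd card Y" if Y: "Y \<in> ?O - {{x0}}" for Y
  proof -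
    obtain x where x: "x \<in> E" "Y = orbit G \<phi> x" using Y by (auto simp: orbits_def)
    have "card Y dvd p ^ a" using orbit_stabilizer_theorem[OF x(1)] x assms by (metis dvd_triv_left)
    then obtain b where b: "card Y = p ^ b" using \<open>nat_prime p\<close> divides_primepow_nat by blast
    have xX: "x \<in> Y" using orbit_refl[OF x(1)] x by auto
    have "b \<noteq> 0"
    proof
      assume "b = 0"
      then have "Y = {x}" using b xX by (auto simp: card_1_singleton_iff)
      then have "\<phi> g x = x" if "g \<in> carrier G" for g using x that unfolding orbit_def by blast
      then have "x = x0" using no x by auto
      then show False using Y \<open>Y = {x}\<close> by auto
    qed
    then show ?thesis using b by simp
  qed
  have finO: "finite ?O" using \<open>finite E\<close> unfolding orbits_def by simp
  have "card E = (\<Sum>Y\<in>?O. card Y)"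
    using disjoint_sum[OF \<open>finite E\<close>, of "\<lambda>_. 1::nat"] by simp
  also have "\<dots> = card {x0} + (\<Sum>Y\<in>?O - {{x0}}. card Y)"
    by (rule sum.remove[OF finO x0O])
  finally have "card E = 1 + (\<Sum>Y\<in>?O - {{x0}}. card Y)" by simp
  moreover have "p dvd (\<Sum>Y\<in>?O - {{x0}}. card Y)" using dvd by (intro dvd_sum) auto
  ultimately have "p dvd 1" using \<open>p dvd card E\<close> dvd_add_left_iff by metis
  then show False using \<open>nat_prime p\<close> by auto
qed


lemma (in group_hom) normal_img:
  assumes surj: "h ` carrier G = carrier H" and N: "N \<lhd> G"
  shows "h ` N \<lhd> H"
proof (subst H.normal_inv_iff, intro conjI ballI)
  show "subgroup (h ` N) H" using subgroup_img_is_subgroup N normal_imp_subgroup by blast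
  fix y k assume y: "y \<in> carrier H" and k: "k \<in> h ` N"
  obtain x where "x \<in> carrier G" "y = h x" using y surj by auto
  moreover obtain n where "n \<in> N" "k = h n" using k by auto
  moreover from calculation have "h (x \<otimes> n \<otimes> inv x) = y \<otimes>\<^bsub>H\<^esub> k \<otimes>\<^bsub>H\<^esub> inv\<^bsub>H\<^esub> y"
    using G.normal_mem_carrier[OF N] by simp
  ultimately show "y \<otimes>\<^bsub>H\<^esub> k \<otimes>\<^bsub>H\<^esub> inv\<^bsub>H\<^esub> y \<in> h ` N" using G.conj_closed[OF N] by (metis imageI)
qed

lemma (in group_hom) cmtr_funpow_img:
  assumes "g \<in> carrier G" "v \<in> carrier G"
  shows "((\<lambda>v. cmtr G v g) ^^ k) v \<in> carrier G \<and>
    h (((\<lambda>v. cmtr G v g) ^^ k) v) = ((\<lambda>v. cmtr H v (h g)) ^^ k) (h v)"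
  by (induction k) (use assms in \<open>auto simp: cmtr_img\<close>)

section \<open>Common fixed points of elementwise nilpotent actions\<close>

context group
begin

text \<open>Let c be the conjugation by \<open>g\<close>. Nilpotency of 1 - c makes c of p-power
  order on \<open>V\<close>, so \<open>G\<close> acts on \<open>V\<close> as a finite p-group
  although \<open>k\<close> varies with \<open>g\<close>, and orbit counting finds a fixed vector
  besides the identity.\<close>

lemma nilpotent_action_fixed_point:
  assumes V: "V \<lhd> G" "finite V" "V \<noteq> {\<one>}"
    and comm: "\<And>u v. u \<in> V \<Longrightarrow> v \<in> V \<Longrightarrow> u \<otimes> v = v \<otimes> u"
    and p: "nat_prime p" and exp: "\<And>v. v \<in> V \<Longrightarrow> v [^] p = \<one>"
    and act: "\<And>g. g \<in> carrier G \<Longrightarrow> \<exists>k. \<forall>v \<in> V. ((\<lambda>v. cmtr G v g) ^^ k) v = \<one>"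
  shows "\<exists>v \<in> V. v \<noteq> \<one> \<and> (\<forall>g \<in> carrier G. cmtr G v g = \<one>)"
proof -
  let ?V = "G\<lparr>carrier := V\<rparr>"
  have sV: "subgroup V G" using V normal_imp_subgroup by auto
  have Vc: "v \<in> carrier G" if "v \<in> V" for v using that normal_mem_carrier[OF V(1)] by auto
  interpret V: group ?V using sV subgroup_imp_group by auto
  interpret V: comm_group ?V by (rule V.group_comm_groupI) (use comm in auto)
  have one: "\<one> \<in> V" using sV by (simp add: subgroup.one_closed)
  \<comment> \<open>Restricted to \<open>V\<close> because the elements of \<open>BijGroup V\<close>
    are extensional.\<close>
  define \<phi> where "\<phi> g = (\<lambda>v\<in>V. g \<otimes> v \<otimes> inv g)" for g
  have phi_mem: "g \<otimes> v \<otimes> inv g \<in> V" if "g \<in> carrier G" "v \<in> V" for g v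
    using conj_closed[OF V(1)] that by auto
  have Bij: "\<phi> g \<in> Bij V" if g: "g \<in> carrier G" for g
  proof -
    have "bij_betw (\<lambda>v. g \<otimes> v \<otimes> inv g) V V"
      by (rule bij_betw_byWitness[where f' = "\<lambda>v. inv g \<otimes> v \<otimes> inv (inv g)"])
        (use g Vc phi_mem[of g] phi_mem[of "inv g"] in \<open>auto simp: word_simps\<close>)
    then show ?thesis unfolding \<phi>_def Bij_def by (auto simp: bij_betw_def inj_on_def)
  qed
  have hom: "\<phi> \<in> hom G (BijGroup V)"
  proof (rule homI)
    fix x y assume x: "x \<in> carrier G" and y: "y \<in> carrier G"
    have "\<phi> (x \<otimes> y) = compose V (\<phi> x) (\<phi> y)"
      unfolding \<phi>_def compose_def by (rule ext) (use x y phi_mem Vc in \<open>auto simp: word_simps\<close>)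
    then show "\<phi> (x \<otimes> y) = \<phi> x \<otimes>\<^bsub>BijGroup V\<^esub> \<phi> y"
      using Bij x y by (simp add: BijGroup_def)
  qed (use Bij in \<open>simp add: BijGroup_def\<close>)
  interpret B: group "BijGroup V" by (rule group_BijGroup)
  interpret phi: group_hom G "BijGroup V" \<phi>
    using hom by (simp add: group_hom_def group_hom_axioms_def is_group B.is_group)
  \<comment> \<open>\<open>G\<close> may be infinite; orbits are counted for its finite
    image.\<close>
  let ?Q = "(BijGroup V)\<lparr>carrier := \<phi> ` carrier G\<rparr>"
  have sQ: "subgroup (\<phi> ` carrier G) (BijGroup V)" by (rule phi.img_is_subgroup)
  interpret Q: group ?Q using B.subgroup_imp_group[OF sQ] .
  have "Bij V \<subseteq> V \<rightarrow>\<^sub>E V" by (auto simp: Bij_def PiE_def dest: bij_betwE)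
  then have "finite (Bij V)" using V(2) finite_PiE finite_subset by metis
  then have finQ: "finite (carrier ?Q)" using Bij finite_subset[of "\<phi> ` carrier G"] by auto
  have triv: "\<exists>k. \<forall>v\<in>V. \<phi> (g [^] (p ^ k)) v = v" if g: "g \<in> carrier G" for g
  proof -
    obtain k where k: "\<forall>v \<in> V. ((\<lambda>v. cmtr G v g) ^^ k) v = \<one>" using act[OF g] by auto
    let ?c = "\<lambda>v. g \<otimes> v \<otimes> inv g"
    have chom: "?c \<in> hom ?V ?V"
      using phi_mem[OF g] g Vc by (auto simp: hom_def word_simps)
    \<comment> \<open>On the abelian \<open>V\<close>, commutation with \<open>g\<close> is the map
      1 - c in multiplicative notation.\<close>
    have "v \<in> V \<Longrightarrow> ((\<lambda>v. v \<otimes>\<^bsub>?V\<^esub> inv\<^bsub>?V\<^esub> (?c v)) ^^ j) v \<in> V \<and>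
       ((\<lambda>v. v \<otimes>\<^bsub>?V\<^esub> inv\<^bsub>?V\<^esub> (?c v)) ^^ j) v = ((\<lambda>v. cmtr G v g) ^^ j) v" for j v
    proof (induction j)
      case (Suc j)
      define w where "w = ((\<lambda>v. cmtr G v g) ^^ j) v"
      have w: "w \<in> V" "((\<lambda>v. v \<otimes>\<^bsub>?V\<^esub> inv\<^bsub>?V\<^esub> (?c v)) ^^ j) v = w" using Suc w_def by auto
      have "w \<otimes>\<^bsub>?V\<^esub> inv\<^bsub>?V\<^esub> (?c w) = cmtr G w g"
        using w phi_mem[OF g] sV g Vc by (simp add: m_inv_consistent cmtr_def word_simps)
      moreover have "cmtr G w g \<in> V" using cmtr_mem_normal[OF V(1)] w g by auto
      ultimately show ?case using w by (simp flip: w_def)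
    qed auto
    then have "v \<in> V \<Longrightarrow> (?c ^^ (p ^ k)) v = v" for v
      using V.unipotent_hom_pow_prime[OF chom _ p, of v k] exp k
      by (simp flip: nat_pow_consistent)
    moreover have "v \<in> V \<Longrightarrow> (?c ^^ n) v = g [^] n \<otimes> v \<otimes> inv (g [^] n)" for n v
    proof (induction n)
      case (Suc n)
      then show ?case using g Vc nat_pow_Suc2[OF g, of n] by (simp add: word_simps del: nat_pow_Suc)
    qed (use Vc in simp)
    ultimately have "\<forall>v\<in>V. \<phi> (g [^] (p ^ k)) v = v"
      by (simp add: \<phi>_def)
    then show ?thesis by blast
  qed
  have Qel: "\<exists>k. f [^]\<^bsub>?Q\<^esub> (p ^ k) = \<one>\<^bsub>?Q\<^esub>" if fQ: "f \<in> carrier ?Q" for f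
  proof -
    obtain g where g: "g \<in> carrier G" "f = \<phi> g" using fQ by auto
    obtain k where k: "\<forall>v\<in>V. \<phi> (g [^] (p ^ k)) v = v" using triv[OF g(1)] by auto
    have "f [^]\<^bsub>?Q\<^esub> (p ^ k) = \<phi> (g [^] (p ^ k))"
      using g phi.hom_nat_pow by (simp flip: B.nat_pow_consistent)
    also have "\<dots> = (\<lambda>x\<in>V. x)"
      by (rule extensionalityI[of _ V]) (use k in \<open>auto simp: \<phi>_def\<close>)
    finally show ?thesis by (auto simp: BijGroup_def)
  qed
  obtain a where a: "order ?Q = p ^ a" using Q.prime_power_order[OF finQ p Qel] by auto
  obtain b where b: "card V = p ^ b"
    using V.prime_power_order[OF _ p] V(2) exp
    by (auto simp: order_def simp flip: nat_pow_consistent) (metis power_one_right)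
  have "card V \<noteq> 1" using V(3) one by (auto simp: card_1_singleton_iff)
  then have "p dvd card V" using b by (cases b) auto
  interpret act: group_action ?Q V id
    unfolding group_action_def by (rule B.canonical_inj_is_hom[OF sQ])
  have "id f \<one> = \<one>" if "f \<in> carrier ?Q" for f
    using that one by (auto simp: \<phi>_def)
  from act.prime_power_fixed_point[OF V(2) p a \<open>p dvd card V\<close> one this]
  obtain y where y: "y \<in> V" "y \<noteq> \<one>" "\<And>g. g \<in> carrier G \<Longrightarrow> \<phi> g y = y" by auto
  have "cmtr G y g = \<one>" if g: "g \<in> carrier G" for g
  proof -
    have "cmtr G y g = y \<otimes> inv (g \<otimes> y \<otimes> inv g)" using g Vc[OF y(1)] by (simp add: cmtr_def word_simps)
    then show ?thesis using y(3)[OF g] y(1) Vc by (simp add: \<phi>_def)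
  qed
  then show ?thesis using y by auto
qed

lemma FactGroup_group_hom:
  assumes "N \<lhd> G"
  shows "group_hom G (G Mod N) (\<lambda>x. N #> x)"
  using normal.factorgroup_is_group[OF assms] normal.r_coset_hom_Mod[OF assms]
  by (simp add: group_hom_def group_hom_axioms_def is_group)

lemma r_coset_eq_iff_mem:
  assumes "subgroup N G" "x \<in> carrier G"
  shows "N #> x = N \<longleftrightarrow> x \<in> N"
  using assms coset_join1 coset_join2 by blast

text \<open>The preceding lemma for the image of \<open>V\<close> in \<open>G Mod N\<close>.
  Phrasing everything by membership in \<open>N\<close> lets the arguments along central series stay
  inside \<open>G\<close>.\<close>

lemma nilpotent_action_fixed_point_mod:
  assumes N: "N \<lhd> G" and V: "V \<lhd> G" and NV: "\<not> V \<subseteq> N" and fin: "finite ((\<lambda>v. N #> v) ` V)"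
    and comm: "\<And>u v. u \<in> V \<Longrightarrow> v \<in> V \<Longrightarrow> cmtr G u v \<in> N"
    and p: "nat_prime p" and exp: "\<And>v. v \<in> V \<Longrightarrow> v [^] p \<in> N"
    and act: "\<And>g. g \<in> carrier G \<Longrightarrow> \<exists>k. \<forall>v \<in> V. ((\<lambda>v. cmtr G v g) ^^ k) v \<in> N"
  shows "\<exists>v \<in> V - N. \<forall>g \<in> carrier G. cmtr G v g \<in> N"
proof -
  let ?Q = "G Mod N" and ?h = "\<lambda>x. N #> x"
  interpret h: group_hom G ?Q ?h by (rule FactGroup_group_hom[OF N])
  have sN: "subgroup N G" using N normal_imp_subgroup by auto
  have Vc: "v \<in> carrier G" if "v \<in> V" for v using that normal_mem_carrier[OF V] by auto
  have surj: "?h ` carrier G = carrier ?Q" by (simp add: carrier_FactGroup)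
  have iff: "?h x = \<one>\<^bsub>?Q\<^esub> \<longleftrightarrow> x \<in> N" if "x \<in> carrier G" for x
    using r_coset_eq_iff_mem[OF sN that] by simp
  have "\<exists>v \<in> ?h ` V. v \<noteq> \<one>\<^bsub>?Q\<^esub> \<and> (\<forall>g \<in> carrier ?Q. cmtr ?Q v g = \<one>\<^bsub>?Q\<^esub>)"
  proof (rule h.H.nilpotent_action_fixed_point[OF h.normal_img[OF surj V] fin _ _ p])
    obtain v where "v \<in> V" "v \<notin> N" using NV by auto
    then show "?h ` V \<noteq> {\<one>\<^bsub>?Q\<^esub>}" using iff Vc by (metis imageI singletonD)
    show "u \<otimes>\<^bsub>?Q\<^esub> v = v \<otimes>\<^bsub>?Q\<^esub> u" if uv: "u \<in> ?h ` V" "v \<in> ?h ` V" for u v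
    proof -
      obtain u' v' where u': "u' \<in> V" "u = ?h u'" "v' \<in> V" "v = ?h v'" using uv by auto
      then have "cmtr ?Q u v = \<one>\<^bsub>?Q\<^esub>"
        using comm[of u' v'] Vc iff h.cmtr_img[of u' v'] by (metis cmtr_closed)
      then show ?thesis using h.H.cmtr_eq_one_iff[of u v] u' Vc h.hom_closed by blast
    qed
    show "v [^]\<^bsub>?Q\<^esub> p = \<one>\<^bsub>?Q\<^esub>" if vV: "v \<in> ?h ` V" for v
    proof -
      obtain v' where v': "v' \<in> V" "v = ?h v'" using vV by auto
      then show ?thesis using h.hom_nat_pow[OF Vc[OF v'(1)], of p] exp[of v'] iff Vc by (metis nat_pow_closed)
    qed
    fix g assume "g \<in> carrier ?Q"
    then obtain g' where g': "g' \<in> carrier G" "g = ?h g'" using surj by auto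
    obtain k where k: "\<forall>v \<in> V. ((\<lambda>v. cmtr G v g') ^^ k) v \<in> N" using act g' by blast
    have "((\<lambda>v. cmtr ?Q v g) ^^ k) (?h v) = \<one>\<^bsub>?Q\<^esub>" if v: "v \<in> V" for v
      using k v g' h.cmtr_funpow_img[OF g'(1) Vc[OF v], of k] iff by metis
    then show "\<exists>k. \<forall>v \<in> ?h ` V. ((\<lambda>v. cmtr ?Q v g) ^^ k) v = \<one>\<^bsub>?Q\<^esub>" by blast
  qed
  then obtain v where v: "v \<in> V" "?h v \<noteq> \<one>\<^bsub>?Q\<^esub>"
    and cv: "\<And>g. g \<in> carrier ?Q \<Longrightarrow> cmtr ?Q (?h v) g = \<one>\<^bsub>?Q\<^esub>" by auto
  have "cmtr G v g \<in> N" if "g \<in> carrier G" for g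
    using cv[OF h.hom_closed[OF that]] iff h.cmtr_img[of v g] Vc[OF v(1)] that by (metis cmtr_closed)
  then show ?thesis using v iff[OF Vc[OF v(1)]] by blast
qed

end

subsection \<open>Finitely generated abelian groups\<close>

text \<open>The maximal condition on subgroups, in the form that is easy to establish along cyclic
  extensions.\<close>

definition all_subgroups_fg :: "('a, 'b) monoid_scheme \<Rightarrow> bool" where
  "all_subgroups_fg G \<longleftrightarrow> (\<forall>H. subgroup H G \<longrightarrow> (\<exists>S. finite S \<and> S \<subseteq> carrier G \<and> H = generate G S))"

lemma (in comm_group) generate_insert_decomp:
  assumes x: "x \<in> carrier G" and S: "S \<subseteq> carrier G" and a: "a \<in> generate G (insert x S)"
  shows "\<exists>k::int. \<exists>y \<in> generate G S. a = x [^] k \<otimes> y"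
  using a
proof (induction rule: generate.induct)
  case one
  then show ?case by (intro exI[of _ 0] bexI[of _ \<one>]) (auto intro: generate.one)
next
  case (incl h)
  then show ?case
  proof
    assume "h = x"
    then show ?thesis using x by (intro exI[of _ 1] bexI[of _ \<one>]) (auto intro: generate.one)
  next
    assume "h \<in> S"
    then show ?thesis using S by (intro exI[of _ 0] bexI[of _ h]) (auto intro: generate.incl)
  qed
next
  case (inv h)
  then show ?case
  proof
    assume "h = x"
    then show ?thesis using x
      by (intro exI[of _ "-1"] bexI[of _ \<one>]) (auto intro: generate.one simp: int_pow_neg)
  next
    assume "h \<in> S"
    then show ?thesis using S by (intro exI[of _ 0] bexI[of _ "inv h"]) (auto intro: generate.inv)
  qed
next
  case (eng h1 h2)
  then obtain k1 k2 :: int and y1 y2 where *: "y1 \<in> generate G S" "h1 = x [^] k1 \<otimes> y1"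
    "y2 \<in> generate G S" "h2 = x [^] k2 \<otimes> y2" by blast
  then have "y1 \<in> carrier G" "y2 \<in> carrier G" using generate_in_carrier[OF S] by auto
  then have "h1 \<otimes> h2 = x [^] (k1 + k2) \<otimes> (y1 \<otimes> y2)"
    using * x by (simp add: int_pow_mult m_ac)
  then show ?case using * generate.eng by metis
qed

text \<open>Modulo n-th powers the exponent of a generator matters only modulo \<open>n\<close>, so
  each generator contributes a factor \<open>n\<close>. For a finitely generated abelian A this
  bounds |A/A^n|, which serves both the finiteness of A in case of exponent \<open>n\<close> and the
  length bound for D/D^p.\<close>

lemma (in comm_group) card_mod_powers_le:
  assumes "finite S" "S \<subseteq> carrier G" "0 < (n::nat)"
  shows "\<exists>F \<subseteq> carrier G. finite F \<and> card F \<le> n ^ card S \<and>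
    (\<forall>a \<in> generate G S. \<exists>b \<in> carrier G. \<exists>f \<in> F. a = b [^] n \<otimes> f)"
  using assms(1,2)
proof (induction S rule: finite_induct)
  case empty
  then show ?case
    by (intro exI[of _ "{\<one>}"]) (auto simp: generate_empty intro: bexI[of _ \<one>])
next
  case (insert x S)
  then obtain F where F: "F \<subseteq> carrier G" "finite F" "card F \<le> n ^ card S"
    "\<And>a. a \<in> generate G S \<Longrightarrow> \<exists>b \<in> carrier G. \<exists>f \<in> F. a = b [^] n \<otimes> f" by blast
  have x: "x \<in> carrier G" using insert by auto
  define F' where "F' = (\<lambda>(i, f). x [^] (i::nat) \<otimes> f) ` ({..<n} \<times> F)"
  have 1: "F' \<subseteq> carrier G" using F x by (auto simp: F'_def)
  have 2: "finite F'" using F by (auto simp: F'_def)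
  have "card F' \<le> card ({..<n} \<times> F)" unfolding F'_def using F(2) by (intro card_image_le) auto
  also have "\<dots> = n * card F" by (simp add: card_cartesian_product)
  also have "\<dots> \<le> n ^ card (insert x S)" using insert F(3) by simp
  finally have 3: "card F' \<le> n ^ card (insert x S)" .
  have "\<exists>b \<in> carrier G. \<exists>f \<in> F'. a = b [^] n \<otimes> f" if a: "a \<in> generate G (insert x S)" for a
  proof -
    obtain k :: int and y where ky: "y \<in> generate G S" "a = x [^] k \<otimes> y"
      using generate_insert_decomp[OF x _ a] insert by auto
    obtain b f where bf: "b \<in> carrier G" "f \<in> F" "y = b [^] n \<otimes> f" using F(4)[OF ky(1)] by auto
    define i where "i = nat (k mod int n)"
    have "k = (k div int n) * int n + int i" using \<open>0 < n\<close> by (simp add: i_def)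
    then have "x [^] k = (x [^] (k div int n)) [^] n \<otimes> x [^] i"
      using x by (metis int_pow_mult int_pow_pow int_pow_int)
    then have "a = (x [^] (k div int n) \<otimes> b) [^] n \<otimes> (x [^] i \<otimes> f)"
      using ky bf x F(1) by (auto simp: nat_pow_distrib m_ac subset_iff)
    moreover have "x [^] i \<otimes> f \<in> F'"
      unfolding F'_def using bf \<open>0 < n\<close> by (auto intro!: image_eqI[of _ _ "(i, f)"] simp: i_def nat_less_iff)
    ultimately show ?thesis using bf x
      by (intro bexI[of _ "x [^] (k div int n) \<otimes> b"] bexI[of _ "x [^] i \<otimes> f"]) auto
  qed
  then show ?case using 1 2 3 by blast
qed

text \<open>Zorn's lemma: the union of a chain is finitely generated, its generators already lie in
  one member, and that member is the union.\<close>

lemma (in group) all_subgroups_fg_maximal: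
  assumes fg: "all_subgroups_fg G" and F: "\<F> \<noteq> {}" and sub: "\<And>H. H \<in> \<F> \<Longrightarrow> subgroup H G"
  shows "\<exists>M \<in> \<F>. \<forall>H \<in> \<F>. M \<subseteq> H \<longrightarrow> H = M"
proof (rule subset_Zorn_nonempty[OF F])
  fix \<C> assume ne: "\<C> \<noteq> {}" and ch: "subset.chain \<F> \<C>"
  have CF: "\<C> \<subseteq> \<F>" and lin: "\<And>A B. A \<in> \<C> \<Longrightarrow> B \<in> \<C> \<Longrightarrow> A \<subseteq> B \<or> B \<subseteq> A"
    using ch by (auto simp: subset.chain_def)
  have "subgroup (\<Union>\<C>) G"
  proof (rule subgroupI)
    show "\<Union>\<C> \<subseteq> carrier G" using CF sub subgroup.subset by blast
    show "\<Union>\<C> \<noteq> {}" using ne CF sub subgroup.one_closed by blast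
    show "inv a \<in> \<Union>\<C>" if "a \<in> \<Union>\<C>" for a
      using that CF sub by (metis UnionE UnionI subgroup.m_inv_closed subsetD)
    fix a b assume "a \<in> \<Union>\<C>" "b \<in> \<Union>\<C>"
    then obtain A where "A \<in> \<C>" "a \<in> A" "b \<in> A" using lin by blast
    then show "a \<otimes> b \<in> \<Union>\<C>" using CF sub by (metis UnionI subgroup.m_closed subsetD)
  qed
  then obtain Y where Y: "finite Y" "Y \<subseteq> carrier G" "\<Union>\<C> = generate G Y"
    using fg by (auto simp: all_subgroups_fg_def)
  have "Y \<subseteq> \<Union>\<C>" using Y(3) generate.incl by auto
  with Y(1) have "\<exists>A \<in> \<C>. Y \<subseteq> A"
  proof (induction Y rule: finite_induct)
    case empty
    then show ?case using ne by auto
  next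
    case (insert y Y)
    then obtain A B where "A \<in> \<C>" "Y \<subseteq> A" "B \<in> \<C>" "y \<in> B" by auto
    then show ?case using lin[of A B] by blast
  qed
  then obtain A where A: "A \<in> \<C>" "Y \<subseteq> A" by auto
  then have "generate G Y \<subseteq> A" using CF sub by (intro generate_subgroup_incl) auto
  then have "\<Union>\<C> = A" using A Y(3) by auto
  then show "\<Union>\<C> \<in> \<F>" using A CF by auto
qed

text \<open>Take a maximal cyclic subgroup <c> containing x = c^m. For a prime p > |m|, a p-th root
  of \<open>x\<close> yields by Bezout a p-th root of \<open>c\<close>, which generates a larger
  cyclic subgroup unless \<open>c\<close> is trivial.\<close>

lemma (in comm_group) torsion_free_fg_not_divisible:
  assumes fg: "all_subgroups_fg G"
    and tf: "\<And>y m. y \<in> carrier G \<Longrightarrow> m \<noteq> 0 \<Longrightarrow> y [^] (m::nat) = \<one> \<Longrightarrow> y = \<one>"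
    and x: "x \<in> carrier G" and root: "\<And>p. nat_prime p \<Longrightarrow> \<exists>y \<in> carrier G. x = y [^] p"
  shows "x = \<one>"
proof (rule ccontr)
  assume "x \<noteq> \<one>"
  have tfi: "y = \<one>" if "y \<in> carrier G" "m \<noteq> 0" "y [^] (m::int) = \<one>" for y m
  proof -
    have "int (ord y) dvd m" using that int_pow_eq_id by auto
    then have "ord y \<noteq> 0" using that by auto
    then show ?thesis using tf[OF that(1), of "ord y"] pow_ord_eq_1[OF that(1)] by auto
  qed
  define \<F> where "\<F> = {generate G {c} | c. c \<in> carrier G \<and> x \<in> generate G {c}}"
  have "generate G {x} \<in> \<F>" unfolding \<F>_def using x by (auto intro: generate.incl)
  then have "\<exists>M \<in> \<F>. \<forall>H \<in> \<F>. M \<subseteq> H \<longrightarrow> H = M"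
    by (intro all_subgroups_fg_maximal[OF fg]) (auto simp: \<F>_def intro: generate_is_subgroup)
  then obtain c where c: "c \<in> carrier G" "x \<in> generate G {c}"
    and max: "\<And>d. d \<in> carrier G \<Longrightarrow> x \<in> generate G {d} \<Longrightarrow> generate G {c} \<subseteq> generate G {d} \<Longrightarrow>
      generate G {d} = generate G {c}"
    unfolding \<F>_def by blast
  obtain m :: int where m: "x = c [^] m" using c generate_pow by auto
  have "m \<noteq> 0" using m \<open>x \<noteq> \<one>\<close> by auto
  obtain p where p: "nat_prime p" "p > nat \<bar>m\<bar>" using bigger_prime by auto
  have "\<not> int p dvd m" using p \<open>m \<noteq> 0\<close> by (auto dest: zdvd_imp_le dvd_imp_le_int)
  then have "coprime m (int p)" using p(1) prime_imp_coprime[of "int p" m] by (simp add: coprime_commute)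
  then obtain u v where uv: "u * m + v * int p = 1" using bezout_int[of m "int p"] by auto
  obtain y where y: "y \<in> carrier G" "x = y [^] p" using root[OF p(1)] by auto
  \<comment> \<open>Chosen so that \<open>d [^] p\<close> is \<open>c [^] (u * m + v * p)\<close>,
    which is \<open>c\<close>.\<close>
  define d where "d = y [^] u \<otimes> c [^] v"
  have d: "d \<in> carrier G" using y c by (simp add: d_def)
  have "d [^] int p = (y [^] int p) [^] u \<otimes> c [^] (v * int p)"
    unfolding d_def using y c by (simp add: int_pow_distrib int_pow_pow mult.commute)
  also have "y [^] int p = c [^] m" using y m by (simp add: int_pow_int)
  finally have dp: "d [^] int p = c"
    using c uv by (simp add: int_pow_pow flip: int_pow_mult) (metis mult.commute int_pow_1)
  then have "c \<in> generate G {d}" using generate_pow[OF d] by auto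
  then have sub: "generate G {c} \<subseteq> generate G {d}"
    by (intro generate_subgroup_incl) (use d generate_is_subgroup in auto)
  then have "d \<in> generate G {c}" using max[OF d] c(2) generate.incl[of d "{d}" G] by auto
  then obtain j :: int where "d = c [^] j" using generate_pow[OF c(1)] by auto
  then have "c [^] (j * int p - 1) = \<one>"
    using dp c by (simp add: int_pow_pow int_pow_diff)
  moreover have "j * int p \<noteq> 1"
    using p(1) by (metis dvd_triv_right int_dvd_int_iff of_nat_1 not_prime_unit)
  ultimately have "c = \<one>" using tfi[OF c(1), of "j * int p - 1"] by auto
  then show False using m \<open>x \<noteq> \<one>\<close> by simp
qed

subsection \<open>Finite nilpotent normal subgroups\<close>

context group
begin

lemma all_subgroups_fg_subgroup:
  assumes "all_subgroups_fg G" "subgroup D G"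
  shows "all_subgroups_fg (G\<lparr>carrier := D\<rparr>)"
  unfolding all_subgroups_fg_def
proof (intro allI impI)
  fix H assume "subgroup H (G\<lparr>carrier := D\<rparr>)"
  then have H: "subgroup H G" "H \<subseteq> D"
    using incl_subgroup[OF assms(2)] subgroup.subset by fastforce+
  then obtain S where S: "finite S" "S \<subseteq> carrier G" "H = generate G S"
    using assms by (auto simp: all_subgroups_fg_def)
  have "S \<subseteq> generate G S" by (auto intro: generate.incl)
  then have "S \<subseteq> D" using H(2) S(3) by simp
  then show "\<exists>S. finite S \<and> S \<subseteq> carrier (G\<lparr>carrier := D\<rparr>) \<and> H = generate (G\<lparr>carrier := D\<rparr>) S"
    using S generate_consistent[OF _ assms(2)] by auto
qed

lemma subgroup_nat_pow_closed: "subgroup H G \<Longrightarrow> x \<in> H \<Longrightarrow> x [^] (n::nat) \<in> H"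
  by (induction n) (auto simp: subgroup.one_closed subgroup.m_closed)

text \<open>\<open>W\<close> is abelian modulo \<open>N\<close>, so the elements killed by
  \<open>n\<close> modulo \<open>N\<close> are closed under products. For trivial \<open>N\<close>
  this is a torsion part; for a hypercentral \<open>N\<close> and prime \<open>n\<close> it gives an
  elementary abelian section.\<close>

lemma exponent_part_normal:
  assumes N: "N \<lhd> G" and W: "W \<lhd> G" and comm: "\<And>u v. u \<in> W \<Longrightarrow> v \<in> W \<Longrightarrow> cmtr G u v \<in> N"
  shows "{v \<in> W. v [^] (n::nat) \<in> N} \<lhd> G" (is "?V \<lhd> G")
proof -
  interpret h: group_hom G "G Mod N" "\<lambda>x. N #> x" by (rule FactGroup_group_hom[OF N])
  have sN: "subgroup N G" and sW: "subgroup W G" using N W normal_imp_subgroup by auto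
  have Wc: "v \<in> carrier G" if "v \<in> W" for v using that normal_mem_carrier[OF W] by auto
  have iff: "N #> x = \<one>\<^bsub>G Mod N\<^esub> \<longleftrightarrow> x \<in> N" if "x \<in> carrier G" for x
    using r_coset_eq_iff_mem[OF sN that] by simp
  have hpow: "v [^] n \<in> N \<longleftrightarrow> (N #> v) [^]\<^bsub>G Mod N\<^esub> n = \<one>\<^bsub>G Mod N\<^esub>" if "v \<in> W" for v
    using h.hom_nat_pow[OF Wc[OF that], of n] iff Wc[OF that] by (metis nat_pow_closed)
  have sub: "subgroup ?V G"
  proof (rule subgroupI)
    show "?V \<subseteq> carrier G" using Wc by auto
    show "?V \<noteq> {}" using subgroup.one_closed[OF sW] subgroup.one_closed[OF sN]
      by (auto intro!: exI[of _ \<one>])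
    fix u assume u: "u \<in> ?V"
    show "inv u \<in> ?V"
      using u subgroup.m_inv_closed[OF sW] subgroup.m_inv_closed[OF sN] Wc by (auto simp: nat_pow_inv)
    fix v assume v: "v \<in> ?V"
    have uc: "u \<in> carrier G" and vc: "v \<in> carrier G" using u v Wc by auto
    have "cmtr (G Mod N) (N #> u) (N #> v) = \<one>\<^bsub>G Mod N\<^esub>"
      using comm[of u v] u v h.cmtr_img[OF uc vc] iff[OF cmtr_closed[OF uc vc]] by auto
    then have "(N #> u) \<otimes>\<^bsub>G Mod N\<^esub> (N #> v) = (N #> v) \<otimes>\<^bsub>G Mod N\<^esub> (N #> u)"
      using h.H.cmtr_eq_one_iff[OF h.hom_closed[OF uc] h.hom_closed[OF vc]] by blast
    then have "((N #> u) \<otimes>\<^bsub>G Mod N\<^esub> (N #> v)) [^]\<^bsub>G Mod N\<^esub> n = \<one>\<^bsub>G Mod N\<^esub>"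
      using h.H.pow_mult_distrib[OF _ h.hom_closed[OF uc] h.hom_closed[OF vc], of n] u v hpow
      by (metis (mono_tags, lifting) h.H.one_closed h.H.l_one mem_Collect_eq)
    then show "u \<otimes> v \<in> ?V"
      using u v hpow[of "u \<otimes> v"] subgroup.m_closed[OF sW] h.hom_mult[OF uc vc] by (metis (mono_tags, lifting) mem_Collect_eq)
  qed
  show ?thesis
    by (subst normal_inv_iff, intro conjI sub ballI)
      (use conj_closed[OF N] conj_closed[OF W] conj_nat_pow Wc in auto)
qed

text \<open>Suppose the terms \<open>T \<inter> upper_central G {\<one>} i\<close> become stationary
  at some \<open>N\<close> below \<open>T\<close>. The nilpotent T/N has a nontrivial centre, whose
  elements of order dividing a suitable prime form an elementary abelian section; a fixed point
  there belongs to the next term but not to \<open>N\<close>.\<close>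

lemma finite_nilpotent_hypercentral:
  assumes T: "T \<lhd> G" "finite T" and nil: "nilpotent_group (G\<lparr>carrier := T\<rparr>)"
    and act: "\<And>g. g \<in> carrier G \<Longrightarrow> \<exists>k. \<forall>v \<in> T. ((\<lambda>v. cmtr G v g) ^^ k) v = \<one>"
  shows "\<exists>m. T \<subseteq> upper_central G {\<one>} m"
proof (rule ccontr)
  assume no: "\<not> ?thesis"
  have sT: "subgroup T G" using T normal_imp_subgroup by auto
  have Tc: "v \<in> carrier G" if "v \<in> T" for v using that normal_mem_carrier[OF T(1)] by auto
  \<comment> \<open>The terms increase inside a finite set, so a term of greatest cardinality equals
    its successor.\<close>
  have "\<exists>m. \<forall>n. card (T \<inter> upper_central G {\<one>} n) \<le> card (T \<inter> upper_central G {\<one>} m)"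
    using ex_has_greatest_nat[of "\<lambda>_. True" 0 "\<lambda>n. card (T \<inter> upper_central G {\<one>} n)" "Suc (card T)"]
      card_mono[OF T(2)] by (auto simp: less_Suc_eq_le)
  then obtain m where m: "\<And>n. card (T \<inter> upper_central G {\<one>} n) \<le> card (T \<inter> upper_central G {\<one>} m)"
    by auto
  define N where "N = T \<inter> upper_central G {\<one>} m"
  have N: "N \<lhd> G" unfolding N_def using T(1) upper_central_normal one_is_normal normal_subgroup_intersect by auto
  then have sN: "subgroup N G" using normal_imp_subgroup by auto
  have oneN: "\<one> \<in> N" using subgroup.one_closed[OF sN] .
  have NSuc: "T \<inter> upper_central G {\<one>} (Suc m) = N"
  proof (rule card_seteq[symmetric])
    show "finite (T \<inter> upper_central G {\<one>} (Suc m))" using T(2) by auto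
    show "N \<subseteq> T \<inter> upper_central G {\<one>} (Suc m)"
      unfolding N_def using upper_central_le_Suc[OF one_is_normal] by blast
  qed (use m[of "Suc m"] in \<open>simp only: N_def\<close>)
  have stable: "v \<in> N" if "v \<in> T" "\<And>g. g \<in> carrier G \<Longrightarrow> cmtr G v g \<in> N" for v
    using that Tc NSuc by (auto simp: N_def)
  have NT: "\<not> T \<subseteq> N" using no by (auto simp: N_def)
  interpret T: group "G\<lparr>carrier := T\<rparr>" using sT subgroup_imp_group by auto
  obtain c where c: "upper_central (G\<lparr>carrier := T\<rparr>) {\<one>} c = T"
    using nil T.nilpotent_iff_upper_central by auto
  \<comment> \<open>The first upper central term of \<open>T\<close> not contained in
    \<open>N\<close> supplies a \<open>v\<close> outside \<open>N\<close> with [v,T] inside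
    \<open>N\<close>.\<close>
  define j where "j = (LEAST j. \<not> upper_central (G\<lparr>carrier := T\<rparr>) {\<one>} j \<subseteq> N)"
  have j: "\<not> upper_central (G\<lparr>carrier := T\<rparr>) {\<one>} j \<subseteq> N"
    unfolding j_def by (rule LeastI[of _ c]) (use c NT in simp)
  then obtain i where i: "j = Suc i" using oneN by (cases j) auto
  have iN: "upper_central (G\<lparr>carrier := T\<rparr>) {\<one>} i \<subseteq> N"
    using not_less_Least[of i "\<lambda>j. \<not> upper_central (G\<lparr>carrier := T\<rparr>) {\<one>} j \<subseteq> N"] i
    by (auto simp: j_def)
  obtain v where v: "v \<in> upper_central (G\<lparr>carrier := T\<rparr>) {\<one>} j" "v \<notin> N" using j by auto
  define W where "W = {v \<in> T. \<forall>t \<in> T. cmtr G v t \<in> N}"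
  have W: "W \<lhd> G" unfolding W_def by (rule relative_center_normal[OF N T(1)])
  have vW: "v \<in> W"
    using v(1) iN cmtr_consistent[OF sT] by (auto simp: i W_def)
  have vc: "v \<in> carrier G" using vW Tc by (auto simp: W_def)
  have "generate G {v} \<subseteq> T" using vW by (intro generate_subgroup_incl[OF _ sT]) (auto simp: W_def)
  then have "finite (generate G {v})" using T(2) finite_subset by auto
  then obtain n0 where "n0 \<noteq> (0::nat)" "v [^] n0 = \<one>"
    using finite_generate_singleton_iff[OF vc] by auto
  then have ex: "0 < n0 \<and> v [^] n0 \<in> N" using oneN by auto
  \<comment> \<open>The order of \<open>v\<close> modulo \<open>N\<close>; for a prime factor p of
    it, the power of \<open>v\<close> with exponent n/p has order p modulo \<open>N\<close>.\<close>
  define n :: nat where "n = (LEAST n. 0 < n \<and> v [^] n \<in> N)"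
  have n: "0 < n" "v [^] n \<in> N"
    using LeastI[of "\<lambda>n::nat. 0 < n \<and> v [^] n \<in> N", OF ex] by (auto simp: n_def)
  have "n \<noteq> 1" using n v(2) vc by auto
  then obtain p where p: "nat_prime p" "p dvd n" using prime_factor_nat by blast
  then obtain l where l: "n = l * p" by (metis dvd_def mult.commute)
  have l0: "0 < l" "l < n" using l n(1) prime_gt_1_nat[OF p(1)] by auto
  have uN: "v [^] l \<notin> N"
    using not_less_Least[of l "\<lambda>n::nat. 0 < n \<and> v [^] n \<in> N"] l0 by (auto simp: n_def)
  define V where "V = {v \<in> W. v [^] p \<in> N}"
  have V: "V \<lhd> G"
    unfolding V_def by (rule exponent_part_normal[OF N W]) (auto simp: W_def)
  have "v [^] l \<in> W"
    using subgroup_nat_pow_closed[OF normal_imp_subgroup[OF W] vW] .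
  then have uV: "v [^] l \<in> V" using n l vc by (auto simp: V_def nat_pow_pow)
  have VT: "V \<subseteq> T" by (auto simp: V_def W_def)
  have "\<exists>v \<in> V - N. \<forall>g \<in> carrier G. cmtr G v g \<in> N"
  proof (rule nilpotent_action_fixed_point_mod[OF N V _ _ _ p(1)])
    show "\<not> V \<subseteq> N" using uV uN by auto
    show "finite ((\<lambda>v. N #> v) ` V)" using T(2) VT finite_subset by blast
    show "cmtr G u v \<in> N" if "u \<in> V" "v \<in> V" for u v using that by (auto simp: V_def W_def)
    show "v [^] p \<in> N" if "v \<in> V" for v using that by (auto simp: V_def)
    show "\<exists>k. \<forall>v \<in> V. ((\<lambda>v. cmtr G v g) ^^ k) v \<in> N" if "g \<in> carrier G" for g
      using act[OF that] oneN VT by (metis subsetD)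
  qed
  then show False using stable VT by auto
qed

text \<open>The same \<open>n\<close> serves all indices; hence the need for a bound that is uniform
  in p.\<close>

lemma upper_central_Inter:
  assumes "I \<noteq> {}"
  shows "(\<Inter>i\<in>I. upper_central G (N i) n) \<subseteq> upper_central G (\<Inter>i\<in>I. N i) n"
proof (induction n)
  case (Suc n)
  then show ?case using assms by (auto simp: subset_iff)
qed auto

lemma power_image_normal:
  assumes D: "D \<lhd> G" and comm: "\<And>u v. u \<in> D \<Longrightarrow> v \<in> D \<Longrightarrow> u \<otimes> v = v \<otimes> u"
  shows "(\<lambda>d. d [^] (n::nat)) ` D \<lhd> G" "(\<lambda>d. d [^] (n::nat)) ` D \<subseteq> D"
proof -
  have sD: "subgroup D G" using D normal_imp_subgroup by auto
  have Dc: "v \<in> carrier G" if "v \<in> D" for v using that normal_mem_carrier[OF D] by auto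
  have sub: "subgroup ((\<lambda>d. d [^] n) ` D) G"
  proof (rule subgroupI)
    show "(\<lambda>d. d [^] n) ` D \<subseteq> carrier G" using Dc by auto
    show "(\<lambda>d. d [^] n) ` D \<noteq> {}" using subgroup.one_closed[OF sD] by auto
    fix a assume "a \<in> (\<lambda>d. d [^] n) ` D"
    then obtain d where d: "d \<in> D" "a = d [^] n" by auto
    then show "inv a \<in> (\<lambda>d. d [^] n) ` D"
      using subgroup.m_inv_closed[OF sD d(1)] Dc by (metis imageI nat_pow_inv)
    fix b assume "b \<in> (\<lambda>d. d [^] n) ` D"
    then obtain e where e: "e \<in> D" "b = e [^] n" by auto
    then have "a \<otimes> b = (d \<otimes> e) [^] n" using d pow_mult_distrib[OF comm] Dc by auto
    then show "a \<otimes> b \<in> (\<lambda>d. d [^] n) ` D" using subgroup.m_closed[OF sD d(1) e(1)] by auto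
  qed
  show "(\<lambda>d. d [^] n) ` D \<lhd> G"
  proof (subst normal_inv_iff, intro conjI sub ballI)
    fix g a assume g: "g \<in> carrier G" and "a \<in> (\<lambda>d. d [^] n) ` D"
    then obtain d where d: "d \<in> D" "a = d [^] n" by auto
    then have "g \<otimes> a \<otimes> inv g = (g \<otimes> d \<otimes> inv g) [^] n" using conj_nat_pow g Dc by auto
    then show "g \<otimes> a \<otimes> inv g \<in> (\<lambda>d. d [^] n) ` D" using conj_closed[OF D g d(1)] by auto
  qed
  show "(\<lambda>d. d [^] n) ` D \<subseteq> D" using subgroup_nat_pow_closed[OF sD] by auto
qed

end

subsection \<open>Unipotent action on torsion-free abelian normal subgroups\<close>

context group
begin

lemma set_mult_memI: "h \<in> H \<Longrightarrow> k \<in> K \<Longrightarrow> h \<otimes> k \<in> H <#> K"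
  by (auto simp: set_mult_def)

lemma subgroup_comm_group:
  assumes "subgroup D G" "\<And>u v. u \<in> D \<Longrightarrow> v \<in> D \<Longrightarrow> u \<otimes> v = v \<otimes> u"
  shows "comm_group (G\<lparr>carrier := D\<rparr>)"
  using subgroup_imp_group[OF assms(1)] assms(2) by (auto intro: group.group_comm_groupI)

lemma subgroup_finitely_generated:
  assumes "all_subgroups_fg G" "subgroup D G"
  obtains S where "finite S" "S \<subseteq> D" "generate (G\<lparr>carrier := D\<rparr>) S = D"
proof -
  interpret D: group "G\<lparr>carrier := D\<rparr>" using subgroup_imp_group[OF assms(2)] .
  show thesis
    using all_subgroups_fg_subgroup[OF assms] D.subgroup_self that by (auto simp: all_subgroups_fg_def)
qed

text \<open>The elements of \<open>D\<close> with trivial n-th power form a finitely generated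
  abelian group of finite exponent, so a finite one, and it is normal in \<open>G\<close>.\<close>

lemma abelian_normal_torsion_free:
  assumes fg: "all_subgroups_fg G" and D: "D \<lhd> G"
    and comm: "\<And>u v. u \<in> D \<Longrightarrow> v \<in> D \<Longrightarrow> u \<otimes> v = v \<otimes> u"
    and nofin: "\<And>F. F \<lhd> G \<Longrightarrow> finite F \<Longrightarrow> F = {\<one>}"
    and d: "d \<in> D" "n \<noteq> 0" "d [^] (n::nat) = \<one>"
  shows "d = \<one>"
proof -
  have Dc: "v \<in> carrier G" if "v \<in> D" for v using that normal_mem_carrier[OF D] by auto
  define E where "E = {v \<in> D. v [^] n \<in> {\<one>}}"
  have E: "E \<lhd> G"
    unfolding E_def
    by (rule exponent_part_normal[OF one_is_normal D]) (use comm Dc cmtr_eq_one_iff in auto)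
  have sE: "subgroup E G" using E normal_imp_subgroup by auto
  interpret E: comm_group "G\<lparr>carrier := E\<rparr>"
    by (rule subgroup_comm_group[OF sE]) (use comm in \<open>auto simp: E_def\<close>)
  obtain S where S: "finite S" "S \<subseteq> E" "generate (G\<lparr>carrier := E\<rparr>) S = E"
    by (rule subgroup_finitely_generated[OF fg sE])
  obtain F where F: "F \<subseteq> E" "finite F"
    "\<And>a. a \<in> E \<Longrightarrow> \<exists>b \<in> E. \<exists>f \<in> F. a = b [^]\<^bsub>G\<lparr>carrier := E\<rparr>\<^esub> n \<otimes> f"
    using E.card_mod_powers_le[of S n] S d(2) by auto
  have "E \<subseteq> F"
  proof
    fix a assume a: "a \<in> E"
    obtain b f where b: "b \<in> E" "f \<in> F" "a = b [^] n \<otimes> f"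
      using F(3)[OF a] by (auto simp flip: nat_pow_consistent)
    then have "a = f" using F(1) Dc by (auto simp: E_def)
    then show "a \<in> F" using b by simp
  qed
  then have "E = {\<one>}" using nofin[OF E] F(2) finite_subset by auto
  then show ?thesis using d by (auto simp: E_def)
qed

text \<open>On an abelian normal subgroup, commutation with a fixed \<open>g\<close> is an
  endomorphism and therefore commutes with powers.\<close>

lemma cmtr_funpow_abelian:
  assumes D: "D \<lhd> G" and comm: "\<And>u v. u \<in> D \<Longrightarrow> v \<in> D \<Longrightarrow> u \<otimes> v = v \<otimes> u"
    and g: "g \<in> carrier G" and d: "d \<in> D"
  shows "((\<lambda>v. cmtr G v g) ^^ k) d \<in> D"
    and "((\<lambda>v. cmtr G v g) ^^ k) (d [^] (n::nat)) = (((\<lambda>v. cmtr G v g) ^^ k) d) [^] n"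
proof -
  have sD: "subgroup D G" using D normal_imp_subgroup by auto
  have Dc: "v \<in> carrier G" if "v \<in> D" for v using that normal_mem_carrier[OF D] by auto
  have cD: "cmtr G v g \<in> D" if "v \<in> D" for v using cmtr_mem_normal[OF D that g] by auto
  have mult: "cmtr G (u \<otimes> v) g = cmtr G u g \<otimes> cmtr G v g" if u: "u \<in> D" and v: "v \<in> D" for u v
  proof -
    have "cmtr G (u \<otimes> v) g = u \<otimes> cmtr G v g \<otimes> inv u \<otimes> cmtr G u g"
      using u v Dc g by (simp add: cmtr_def word_simps)
    also have "u \<otimes> cmtr G v g \<otimes> inv u = cmtr G v g"
      using comm[OF u cD[OF v]] u Dc cD[OF v] by (simp add: word_simps)
    finally show ?thesis using comm[OF cD[OF u] cD[OF v]] by simp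
  qed
  have pow: "cmtr G (v [^] m) g = (cmtr G v g) [^] m" if v: "v \<in> D" for v and m :: nat
  proof (induction m)
    case 0
    then show ?case using g by (simp add: cmtr_def)
  qed (use mult[OF subgroup_nat_pow_closed[OF sD v] v] in simp)
  show 1: "((\<lambda>v. cmtr G v g) ^^ k) d \<in> D" for k by (induction k) (use d cD in auto)
  show "((\<lambda>v. cmtr G v g) ^^ k) (d [^] n) = (((\<lambda>v. cmtr G v g) ^^ k) d) [^] n"
    by (induction k) (use pow 1 in auto)
qed

text \<open>Nilpotent groups are Engel: \<open>k\<close> is the length of the upper central series
  and serves all pairs at once.\<close>

lemma nilpotent_cmtr_funpow:
  assumes H: "subgroup H G" and nil: "nilpotent_group (G\<lparr>carrier := H\<rparr>)"
  shows "\<exists>k. \<forall>x \<in> H. \<forall>g \<in> H. ((\<lambda>v. cmtr G v g) ^^ k) x = \<one>"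
proof -
  interpret H: group "G\<lparr>carrier := H\<rparr>" using H subgroup_imp_group by auto
  obtain n where n: "upper_central (G\<lparr>carrier := H\<rparr>) {\<one>} n = H"
    using nil H.nilpotent_iff_upper_central by auto
  have "x \<in> upper_central (G\<lparr>carrier := H\<rparr>) {\<one>} n \<Longrightarrow> g \<in> H \<Longrightarrow>
     ((\<lambda>v. cmtr G v g) ^^ n) x = \<one>" for n x g
  proof (induction n arbitrary: x)
    case (Suc n)
    then have "cmtr G x g \<in> upper_central (G\<lparr>carrier := H\<rparr>) {\<one>} n"
      using cmtr_consistent[OF H, of x g] by auto
    then show ?case using Suc by (simp only: funpow_Suc_right comp_apply)
  qed auto
  then show ?thesis using n by blast
qed

lemma meta_nil_hamiltonian_unipotent:
  assumes mnh: "meta_nil_hamiltonian G" and fg: "all_subgroups_fg G" and D: "D \<lhd> G"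
    and comm: "\<And>u v. u \<in> D \<Longrightarrow> v \<in> D \<Longrightarrow> u \<otimes> v = v \<otimes> u"
    and tf: "\<And>d n. d \<in> D \<Longrightarrow> n \<noteq> 0 \<Longrightarrow> d [^] (n::nat) = \<one> \<Longrightarrow> d = \<one>"
    and g: "g \<in> carrier G"
  shows "\<exists>k. \<forall>d \<in> D. ((\<lambda>v. cmtr G v g) ^^ k) d = \<one>"
proof -
  have sD: "subgroup D G" using D normal_imp_subgroup by auto
  have Dc: "v \<in> carrier G" if "v \<in> D" for v using that normal_mem_carrier[OF D] by auto
  define P where "P p = (\<lambda>d. d [^] (p::nat)) ` D" for p
  define H where "H p = P p <#> generate G {g}" for p
  have P: "P p \<lhd> G" "P p \<subseteq> D" for p unfolding P_def using power_image_normal[OF D comm] by auto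
  have gen: "subgroup (generate G {g}) G" using generate_is_subgroup g by auto
  have H: "subgroup (H p) G" for p unfolding H_def by (rule mult_norm_subgroup[OF P(1) gen])
  have gH: "g \<in> H p" for p
  proof -
    have "\<one> \<in> P p" using P(1) normal_imp_subgroup subgroup.one_closed by blast
    then show ?thesis
      unfolding H_def using set_mult_memI[OF _ generate.incl[of g "{g}" G], of \<one> "P p"] g by simp
  qed
  have PH: "P p \<subseteq> H p" for p
    unfolding H_def using set_mult_memI[OF _ generate.one[of G "{g}"], of _ "P p"] P(2) Dc by fastforce
  show ?thesis
  proof (cases "\<exists>p. nat_prime p \<and> nilpotent_group (G\<lparr>carrier := H p\<rparr>)")
    case True
    then obtain p where p: "nat_prime p" "nilpotent_group (G\<lparr>carrier := H p\<rparr>)" by auto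
    obtain k where k: "\<forall>x \<in> H p. \<forall>g \<in> H p. ((\<lambda>v. cmtr G v g) ^^ k) x = \<one>"
      using nilpotent_cmtr_funpow[OF H p(2)] by auto
    \<comment> \<open>Nilpotency of \<open>H p\<close> controls only p-th powers of elements of
      \<open>D\<close>; as \<open>D\<close> is torsion-free, this passes to the elements
      themselves.\<close>
    have "((\<lambda>v. cmtr G v g) ^^ k) d = \<one>" if d: "d \<in> D" for d
    proof -
      have "d [^] p \<in> H p" using d PH by (auto simp: P_def)
      then have "(((\<lambda>v. cmtr G v g) ^^ k) d) [^] p = \<one>"
        using k gH cmtr_funpow_abelian(2)[OF D comm g d] by metis
      moreover have "p \<noteq> 0" using p(1) by auto
      ultimately show ?thesis using tf cmtr_funpow_abelian(1)[OF D comm g d] by metis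
    qed
    then show ?thesis by auto
  next
    case False
    then have HN: "H p \<lhd> G" if "nat_prime p" for p
      using mnh H that by (auto simp: meta_nil_hamiltonian_def)
    interpret D: comm_group "G\<lparr>carrier := D\<rparr>" by (rule subgroup_comm_group[OF sD comm])
    have "cmtr G (cmtr G d g) g = \<one>" if d: "d \<in> D" for d
    proof -
      let ?c = "cmtr G d g"
      have cD: "cmtr G v g \<in> D" if "v \<in> D" for v using cmtr_mem_normal[OF D that g] by auto
      have root: "\<exists>y \<in> D. cmtr G ?c g = y [^] p" if p: "nat_prime p" for p
      proof -
        \<comment> \<open>\<open>g\<close> lies in the normal subgroup \<open>H p\<close>, hence so
          does [d,g] = b^p z with \<open>z\<close> a power of \<open>g\<close>. The factor
          \<open>z\<close> commutes with \<open>g\<close> and drops out of the second commutator,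
          leaving [b,g]^p.\<close>
        have "?c \<in> H p" using cmtr_mem_normal(2)[OF HN[OF p] gH] d Dc by auto
        then obtain b z where b: "b \<in> D" "z \<in> generate G {g}" "?c = b [^] p \<otimes> z"
          by (auto simp: H_def P_def set_mult_def)
        obtain i :: int where i: "z = g [^] i" using b generate_pow[OF g] by auto
        have zg: "z \<otimes> g = g \<otimes> z" and zc: "z \<in> carrier G"
          unfolding i using g int_pow_mult[OF g, of i 1] int_pow_mult[OF g, of 1 i]
          by (simp_all add: add.commute)
        have bc: "b [^] p \<in> carrier G" using Dc b by auto
        have "cmtr G ?c g = b [^] p \<otimes> (z \<otimes> g) \<otimes> inv z \<otimes> inv (b [^] p) \<otimes> inv g"
          unfolding b(3) using bc zc g by (simp add: cmtr_def m_assoc inv_mult_group)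
        also have "\<dots> = cmtr G (b [^] p) g"
          unfolding zg cmtr_def using bc zc g by (simp add: word_simps)
        also have "\<dots> = cmtr G b g [^] p" using cmtr_funpow_abelian(2)[OF D comm g b(1), of 1] by simp
        finally show ?thesis using cD[OF b(1)] by auto
      qed
      show ?thesis
        using D.torsion_free_fg_not_divisible[OF all_subgroups_fg_subgroup[OF fg sD], of "cmtr G ?c g"]
          tf root cD[OF cD[OF d]] by (simp flip: nat_pow_consistent)
    qed
    then have "\<forall>d \<in> D. ((\<lambda>v. cmtr G v g) ^^ 2) d = \<one>" by (simp add: numeral_2_eq_2)
    then show ?thesis by blast
  qed
qed

text \<open>While \<open>N i\<close> is not all of \<open>D\<close>, a fixed point modulo
  \<open>N i\<close> makes the next term larger. All quotients D/N_i have p-power order, so the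
  order falls by a factor of at least p each time, starting from at most p^r with
  \<open>r = card S\<close>.\<close>

lemma unipotent_hypercentral_mod_powers:
  assumes D: "D \<lhd> G" and comm: "\<And>u v. u \<in> D \<Longrightarrow> v \<in> D \<Longrightarrow> u \<otimes> v = v \<otimes> u"
    and S: "finite S" "S \<subseteq> D" "generate (G\<lparr>carrier := D\<rparr>) S = D"
    and act: "\<And>g. g \<in> carrier G \<Longrightarrow> \<exists>k. \<forall>d \<in> D. ((\<lambda>v. cmtr G v g) ^^ k) d = \<one>"
    and p: "nat_prime p"
  shows "D \<subseteq> upper_central G ((\<lambda>d. d [^] p) ` D) (card S)"
proof -
  have sD: "subgroup D G" using D normal_imp_subgroup by auto
  have Dc: "v \<in> carrier G" if "v \<in> D" for v using that normal_mem_carrier[OF D] by auto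
  interpret D: comm_group "G\<lparr>carrier := D\<rparr>" by (rule subgroup_comm_group[OF sD comm])
  define P where "P = (\<lambda>d. d [^] p) ` D"
  have P: "P \<lhd> G" "P \<subseteq> D" unfolding P_def using power_image_normal[OF D comm] by auto
  define r where "r = card S"
  have p0: "0 < p" using p prime_gt_0_nat by auto
  obtain F where F: "F \<subseteq> D" "finite F" "card F \<le> p ^ r"
    "\<And>a. a \<in> D \<Longrightarrow> \<exists>b \<in> D. \<exists>f \<in> F. a = b [^]\<^bsub>G\<lparr>carrier := D\<rparr>\<^esub> p \<otimes> f"
    using D.card_mod_powers_le[of S p] S p0 by (auto simp: r_def)
  define N where "N i = D \<inter> upper_central G P i" for i
  have N: "N i \<lhd> G" for i
    unfolding N_def using D upper_central_normal[OF P(1)] normal_subgroup_intersect by auto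
  have sN: "subgroup (N i) G" for i using N normal_imp_subgroup by auto
  have PN: "P \<subseteq> N i" for i
    using upper_central_incseq[OF P(1), of 0 i] P(2) by (auto simp: N_def)
  have NSuc: "N i \<subseteq> N (Suc i)" for i
    using upper_central_le_Suc[OF P(1)] by (auto simp: N_def simp del: upper_central.simps)
  define C where "C i = (\<lambda>d. N i #> d) ` D" for i
  have CF: "C i \<subseteq> (\<lambda>f. N i #> f) ` F" for i
  proof
    fix K assume "K \<in> C i"
    then obtain a where a: "a \<in> D" "K = N i #> a" by (auto simp: C_def)
    obtain b f where bf: "b \<in> D" "f \<in> F" "a = b [^] p \<otimes> f"
      using F(4)[OF a(1)] by (auto simp flip: nat_pow_consistent)
    then have "b [^] p \<in> N i" using PN by (auto simp: P_def)
    then have "a \<in> N i #> f" using bf by (auto simp: r_coset_def)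
    then have "N i #> f = N i #> a" using repr_independence[OF _ _ sN] bf F(1) Dc by auto
    then show "K \<in> (\<lambda>f. N i #> f) ` F" using a bf by auto
  qed
  have finC: "finite (C i)" for i using CF F(2) finite_subset by blast
  have cardC: "card (C i) \<le> p ^ r" for i
    using card_mono[OF _ CF] card_image_le[OF F(2)] F(2,3) by (meson finite_imageI order_trans)
  have Cpow: "\<exists>a. card (C i) = p ^ a" for i
  proof -
    let ?Q = "G\<lparr>carrier := D\<rparr> Mod N i"
    have NiD: "N i \<lhd> G\<lparr>carrier := D\<rparr>"
      using D.subgroup_imp_normal subgroup_incl[OF sN sD] by (auto simp: N_def)
    interpret h: group_hom "G\<lparr>carrier := D\<rparr>" ?Q "\<lambda>x. N i #> x"
      using D.FactGroup_group_hom[OF NiD] by simp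
    have car: "carrier ?Q = C i" by (simp add: carrier_FactGroup C_def)
    have "\<exists>a. order ?Q = p ^ a"
    proof (rule h.H.prime_power_order[OF _ p])
      show "finite (carrier ?Q)" using finC car by simp
      fix K assume "K \<in> carrier ?Q"
      then obtain d where d: "d \<in> D" "K = N i #> d" using car by (auto simp: C_def)
      have "N i #> (d [^] p) = N i"
        by (rule coset_join2[OF _ sN]) (use PN d Dc in \<open>auto simp: P_def\<close>)
      then have "K [^]\<^bsub>?Q\<^esub> p = \<one>\<^bsub>?Q\<^esub>"
        using h.hom_nat_pow[of d p] d by (simp flip: nat_pow_consistent)
      then show "\<exists>k. K [^]\<^bsub>?Q\<^esub> (p ^ k) = \<one>\<^bsub>?Q\<^esub>" by (metis power_one_right)
    qed
    then show ?thesis using car by (simp add: order_def)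
  qed
  have step: "p * card (C (Suc i)) \<le> card (C i)" if nD: "\<not> D \<subseteq> N i" for i
  proof -
    have "\<exists>v \<in> D - N i. \<forall>g \<in> carrier G. cmtr G v g \<in> N i"
    proof (rule nilpotent_action_fixed_point_mod[OF N D nD _ _ p])
      show "finite ((\<lambda>v. N i #> v) ` D)" using finC by (simp add: C_def)
      show "cmtr G u v \<in> N i" if "u \<in> D" "v \<in> D" for u v
        using that cmtr_eq_one_iff comm Dc subgroup.one_closed[OF sN] by metis
      show "v [^] p \<in> N i" if "v \<in> D" for v using that PN by (auto simp: P_def)
      show "\<exists>k. \<forall>v \<in> D. ((\<lambda>v. cmtr G v g) ^^ k) v \<in> N i" if "g \<in> carrier G" for g
        using act[OF that] subgroup.one_closed[OF sN] by metis
    qed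
    then obtain v where v: "v \<in> D" "v \<notin> N i" "\<And>g. g \<in> carrier G \<Longrightarrow> cmtr G v g \<in> N i" by auto
    have vS: "v \<in> N (Suc i)" using v Dc by (auto simp: N_def)
    have mult: "N (Suc i) <#> (N i #> d) = N (Suc i) #> d" if "d \<in> D" for d
    proof -
      have "N (Suc i) <#> (N i #> d) = (N (Suc i) <#> N i) #> d"
        using setmult_rcos_assoc[of "N (Suc i)" "N i" d] subgroup.subset[OF sN] Dc[OF that] by auto
      also have "N (Suc i) <#> N i = N (Suc i)"
      proof
        show "N (Suc i) <#> N i \<subseteq> N (Suc i)"
          using NSuc[of i] subgroup.m_closed[OF sN[of "Suc i"]] by (auto simp: set_mult_def subset_iff)
        show "N (Suc i) \<subseteq> N (Suc i) <#> N i"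
          using set_mult_memI[OF _ subgroup.one_closed[OF sN, of i], of _ "N (Suc i)"]
            subgroup.mem_carrier[OF sN] by fastforce
      qed
      finally show ?thesis .
    qed
    \<comment> \<open>Sends the cosets of \<open>N i\<close> in \<open>D\<close> onto those of
      \<open>N (Suc i)\<close>, and identifies the cosets of \<open>v\<close> and of the
      identity.\<close>
    let ?f = "\<lambda>K. N (Suc i) <#> K"
    have img: "C (Suc i) = ?f ` C i"
      unfolding C_def image_image using mult by auto
    have one: "\<one> \<in> D" using subgroup.one_closed[OF sD] .
    have "\<not> inj_on ?f (C i)"
    proof
      assume inj: "inj_on ?f (C i)"
      have "?f (N i #> v) = ?f (N i #> \<one>)"
        using mult[OF v(1)] mult[OF one] coset_join2[OF _ sN vS] coset_join2[OF _ sN subgroup.one_closed[OF sN]]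
          Dc[OF v(1)] by simp
      then have "N i #> v = N i #> \<one>" using inj v(1) one by (auto simp: C_def dest: inj_onD)
      then have "N i #> v = N i" using subgroup.subset[OF sN] by simp
      then show False using r_coset_eq_iff_mem[OF sN Dc[OF v(1)]] v(2) by simp
    qed
    then have "card (C (Suc i)) < card (C i)"
      using card_image_le[OF finC[of i], of ?f] eq_card_imp_inj_on[OF finC[of i], of ?f] img by force
    moreover obtain a b where "card (C (Suc i)) = p ^ a" "card (C i) = p ^ b" using Cpow by metis
    moreover have "1 < p" using p prime_gt_1_nat by auto
    ultimately have "p ^ Suc a \<le> p ^ b"
      by (metis Suc_leI power_increasing power_less_imp_less_exp less_imp_le_nat)
    then show ?thesis using \<open>card (C (Suc i)) = p ^ a\<close> \<open>card (C i) = p ^ b\<close> by simp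
  qed
  have "D \<subseteq> N i \<or> p ^ i * card (C i) \<le> p ^ r" for i
  proof (induction i)
    case 0
    then show ?case using cardC by simp
  next
    case (Suc i)
    show ?case
    proof (cases "D \<subseteq> N i")
      case True
      then show ?thesis using NSuc by blast
    next
      case False
      have "p ^ Suc i * card (C (Suc i)) = p ^ i * (p * card (C (Suc i)))" by simp
      also have "\<dots> \<le> p ^ i * card (C i)" using step[OF False] by simp
      also have "\<dots> \<le> p ^ r" using Suc False by simp
      finally show ?thesis by simp
    qed
  qed
  \<comment> \<open>After \<open>r\<close> steps the count leaves room for a single coset.\<close>
  from this[of r] have "D \<subseteq> N r"
  proof
    assume "p ^ r * card (C r) \<le> p ^ r"
    then have "card (C r) \<le> 1" using p0 by simp
    moreover have "N r #> \<one> \<in> C r" using subgroup.one_closed[OF sD] by (auto simp: C_def)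
    ultimately have "C r = {N r #> \<one>}" using finC[of r] by (metis card_le_Suc0_iff_eq One_nat_def is_singletonI' is_singleton_the_elem singletonD empty_iff)
    then have "N r #> d = N r" if "d \<in> D" for d
      using that subgroup.subset[OF sN] by (auto simp: C_def)
    then show ?thesis using r_coset_eq_iff_mem[OF sN Dc] by auto
  qed
  then show ?thesis by (auto simp: N_def P_def r_def)
qed

end

subsection \<open>No finite normal subgroups\<close>

text \<open>Finiteness of the image of \<open>A\<close> modulo \<open>N\<close>, without asking that
  \<open>A\<close> contain \<open>N\<close>; this is the form required for the derived subgroup and
  an arbitrary normal \<open>N\<close>.\<close>

definition finite_mod :: "('a, 'b) monoid_scheme \<Rightarrow> 'a set \<Rightarrow> 'a set \<Rightarrow> bool" where
  "finite_mod G N A \<longleftrightarrow> (\<exists>F. finite F \<and> F \<subseteq> carrier G \<and> A \<subseteq> N <#>\<^bsub>G\<^esub> F)"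

text \<open>The derived series of \<open>N\<close> is formed in \<open>G\<close>, so that each of
  its terms inherits normality in \<open>G\<close>.\<close>

definition virtually_solvable :: "('a, 'b) monoid_scheme \<Rightarrow> bool" where
  "virtually_solvable G \<longleftrightarrow>
     (\<exists>N n. N \<lhd> G \<and> finite_mod G N (carrier G) \<and> (derived G ^^ n) N = {\<one>\<^bsub>G\<^esub>})"

lemma (in group_hom) subgroup_preimage:
  assumes sK: "subgroup K H"
  shows "subgroup {x \<in> carrier G. h x \<in> K} G"
  by (rule G.subgroupI)
    (use subgroup.one_closed[OF sK] subgroup.m_closed[OF sK] subgroup.m_inv_closed[OF sK]
     in \<open>auto intro!: exI[of _ "\<one>\<^bsub>G\<^esub>"]\<close>)

lemma (in group_hom) normal_preimage:
  assumes K: "K \<lhd> H"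
  shows "{x \<in> carrier G. h x \<in> K} \<lhd> G"
proof (subst G.normal_inv_iff, intro conjI ballI)
  show "subgroup {x \<in> carrier G. h x \<in> K} G"
    using subgroup_preimage K normal_imp_subgroup by auto
  show "x \<otimes> y \<otimes> inv x \<in> {x \<in> carrier G. h x \<in> K}"
    if "x \<in> carrier G" "y \<in> {x \<in> carrier G. h x \<in> K}" for x y
    using that H.conj_closed[OF K] by auto
qed

lemma (in group_hom) finite_mod_img:
  assumes "finite_mod G N A" "N \<subseteq> carrier G"
  shows "finite_mod H (h ` N) (h ` A)"
proof -
  obtain F where F: "finite F" "F \<subseteq> carrier G" "A \<subseteq> N <#> F"
    using assms by (auto simp: finite_mod_def)
  have "h ` A \<subseteq> h ` N <#>\<^bsub>H\<^esub> h ` F"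
    using F(2,3) assms(2) by (fastforce simp: set_mult_def subset_iff)
  then show ?thesis using F unfolding finite_mod_def by (intro exI[of _ "h ` F"]) auto
qed

section \<open>Covering by finitely many cosets\<close>

context group
begin

lemma finite_mod_mono: "finite_mod G N A \<Longrightarrow> N \<subseteq> M \<Longrightarrow> finite_mod G M A"
  unfolding finite_mod_def using mono_set_mult by (metis subset_refl subset_trans)

lemma finite_mod_finite: "finite_mod G N A \<Longrightarrow> finite N \<Longrightarrow> finite A"
  unfolding finite_mod_def set_mult_def by (auto intro: finite_subset)

lemma finite_mod_imp_finite_rcosets:
  assumes "finite_mod G Z P" "subgroup Z G"
  shows "finite (rcosets\<^bsub>G\<lparr>carrier := P\<rparr>\<^esub> Z)"
proof -
  obtain F where F: "finite F" "F \<subseteq> carrier G" "P \<subseteq> Z <#> F"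
    using assms by (auto simp: finite_mod_def)
  have "rcosets\<^bsub>G\<lparr>carrier := P\<rparr>\<^esub> Z \<subseteq> (\<lambda>f. Z #> f) ` F"
  proof
    fix K assume "K \<in> rcosets\<^bsub>G\<lparr>carrier := P\<rparr>\<^esub> Z"
    then obtain x where x: "x \<in> P" "K = Z #> x" by (auto simp: RCOSETS_def)
    then have "x \<in> Z <#> F" using F(3) by auto
    then obtain f where f: "f \<in> F" "x \<in> Z #> f" by (auto simp: set_mult_def r_coset_def)
    then have "Z #> f = Z #> x" using repr_independence[OF _ _ assms(2)] F(2) by auto
    then show "K \<in> (\<lambda>f. Z #> f) ` F" using f x by auto
  qed
  then show ?thesis using F(1) finite_subset by blast
qed

text \<open>One representative per fibre is enough. This is how finite index is read off from an
  action on a finite set or from a coset map.\<close>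

lemma finite_mod_fibres:
  assumes C: "subgroup C G" and A: "A \<subseteq> carrier G" and fin: "finite (f ` A)"
    and fib: "\<And>g g'. g \<in> A \<Longrightarrow> g' \<in> A \<Longrightarrow> f g = f g' \<Longrightarrow> g \<otimes> inv g' \<in> C"
  shows "finite_mod G C A"
proof -
  define r where "r y = (SOME g. g \<in> A \<and> f g = y)" for y
  have r: "r (f g) \<in> A" "f (r (f g)) = f g" if "g \<in> A" for g
    using someI[of "\<lambda>h. h \<in> A \<and> f h = f g" g] that by (auto simp: r_def)
  have "g \<in> C <#> (r ` f ` A)" if g: "g \<in> A" for g
  proof -
    have "g \<otimes> inv (r (f g)) \<in> C" using fib r g by simp
    moreover have "g \<in> carrier G" "r (f g) \<in> carrier G" using g r A by auto
    then have "g = (g \<otimes> inv (r (f g))) \<otimes> r (f g)" by (simp add: word_simps)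
    ultimately show ?thesis using set_mult_memI[of "g \<otimes> inv (r (f g))" C "r (f g)"] g by fastforce
  qed
  then show ?thesis
    using fin r A unfolding finite_mod_def by (intro exI[of _ "r ` f ` A"]) auto
qed

lemma finite_rcosets_imp_finite_mod:
  assumes "subgroup N G" "finite (rcosets N)"
  shows "finite_mod G N (carrier G)"
proof (rule finite_mod_fibres[OF assms(1) subset_refl, of "\<lambda>g. N #> g"])
  show "finite ((\<lambda>g. N #> g) ` carrier G)"
    using assms(2) by (simp add: RCOSETS_def image_def) (metis UNION_singleton_eq_range image_def)
  show "g \<otimes> inv g' \<in> N" if "g \<in> carrier G" "g' \<in> carrier G" "N #> g = N #> g'" for g g'
    using that rcos_self[OF that(1) assms(1)] subgroup.rcos_module_imp[OF assms(1) is_group] by auto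
qed

lemma cmtr_mem_derived: "x \<in> A \<Longrightarrow> y \<in> A \<Longrightarrow> cmtr G x y \<in> derived G A"
  unfolding derived_def cmtr_def by (rule generate.incl) auto

lemma derived_subset_iff:
  assumes "subgroup M G"
  shows "derived G (carrier G) \<subseteq> M \<longleftrightarrow> (\<forall>x \<in> carrier G. \<forall>y \<in> carrier G. cmtr G x y \<in> M)"
proof
  show "derived G (carrier G) \<subseteq> M \<Longrightarrow> \<forall>x \<in> carrier G. \<forall>y \<in> carrier G. cmtr G x y \<in> M"
    using cmtr_mem_derived by blast
  assume "\<forall>x \<in> carrier G. \<forall>y \<in> carrier G. cmtr G x y \<in> M"
  then show "derived G (carrier G) \<subseteq> M"
    unfolding derived_def by (intro generate_subgroup_incl[OF _ assms]) (auto simp: cmtr_def)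
qed

lemma set_mult_normal:
  assumes M: "M \<lhd> G" and N: "N \<lhd> G"
  shows "M <#> N \<lhd> G" "M \<subseteq> M <#> N" "N \<subseteq> M <#> N"
proof -
  have sM: "subgroup M G" and sN: "subgroup N G" using M N normal_imp_subgroup by auto
  have c: "x \<in> carrier G" if "x \<in> M \<or> x \<in> N" for x
    using normal_mem_carrier[OF M] normal_mem_carrier[OF N] that by auto
  show "M <#> N \<lhd> G"
  proof (subst normal_inv_iff, intro conjI ballI)
    show "subgroup (M <#> N) G" by (rule mult_norm_subgroup[OF M sN])
    fix g x assume g: "g \<in> carrier G" and "x \<in> M <#> N"
    then obtain a b where ab: "a \<in> M" "b \<in> N" "x = a \<otimes> b" by (auto simp: set_mult_def)
    have "g \<otimes> x \<otimes> inv g = (g \<otimes> a \<otimes> inv g) \<otimes> (g \<otimes> b \<otimes> inv g)"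
      using g ab c by (simp add: word_simps)
    then show "g \<otimes> x \<otimes> inv g \<in> M <#> N"
      using conj_closed[OF M g ab(1)] conj_closed[OF N g ab(2)] set_mult_memI by auto
  qed
  show "M \<subseteq> M <#> N"
    using set_mult_memI[OF _ subgroup.one_closed[OF sN], of _ M] c by fastforce
  show "N \<subseteq> M <#> N"
    using set_mult_memI[OF subgroup.one_closed[OF sM], of _ N] c by fastforce
qed

text \<open>The last nontrivial term of the derived series of a solvable normal subgroup of finite
  index.\<close>

lemma exists_abelian_normal:
  assumes vs: "virtually_solvable G" and inf: "infinite (carrier G)"
  shows "\<exists>D. D \<lhd> G \<and> D \<noteq> {\<one>} \<and> (\<forall>u \<in> D. \<forall>v \<in> D. u \<otimes> v = v \<otimes> u)"
proof -
  obtain N n where N: "N \<lhd> G" "finite_mod G N (carrier G)" and n: "(derived G ^^ n) N = {\<one>}"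
    using vs by (auto simp: virtually_solvable_def)
  have "N \<noteq> {\<one>}" using finite_mod_finite[OF N(2)] inf by auto
  define m where "m = (LEAST n. (derived G ^^ n) N = {\<one>})"
  have m: "(derived G ^^ m) N = {\<one>}" unfolding m_def by (rule LeastI[of _ n]) (rule n)
  then obtain l where l: "m = Suc l" using \<open>N \<noteq> {\<one>}\<close> by (cases m) auto
  define D where "D = (derived G ^^ l) N"
  have D: "D \<lhd> G" unfolding D_def by (induction l) (use N derived_is_normal in auto)
  moreover have "D \<noteq> {\<one>}"
    using not_less_Least[of l "\<lambda>n. (derived G ^^ n) N = {\<one>}"] l by (auto simp: m_def D_def)
  moreover have "u \<otimes> v = v \<otimes> u" if "u \<in> D" "v \<in> D" for u v
    using cmtr_mem_derived[OF that] m l normal_mem_carrier[OF D] that cmtr_eq_one_iff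
    by (auto simp: D_def)
  ultimately show ?thesis by blast
qed

text \<open>With r generators of \<open>D\<close>, the r-fold commutators of \<open>D\<close> with
  \<open>G\<close> lie in every D^p. These intersect trivially, so \<open>D\<close> is hypercentral,
  and such a normal subgroup meets the centre.\<close>

lemma exists_central_element:
  assumes mnh: "meta_nil_hamiltonian G" and fg: "all_subgroups_fg G"
    and nofin: "\<And>F. F \<lhd> G \<Longrightarrow> finite F \<Longrightarrow> F = {\<one>}"
    and D: "D \<lhd> G" "D \<noteq> {\<one>}" and comm: "\<And>u v. u \<in> D \<Longrightarrow> v \<in> D \<Longrightarrow> u \<otimes> v = v \<otimes> u"
  shows "\<exists>z \<in> D. z \<noteq> \<one> \<and> (\<forall>g \<in> carrier G. cmtr G z g = \<one>)"
proof -
  have sD: "subgroup D G" using D normal_imp_subgroup by auto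
  have Dc: "v \<in> carrier G" if "v \<in> D" for v using that normal_mem_carrier[OF D(1)] by auto
  have tf: "d = \<one>" if "d \<in> D" "n \<noteq> 0" "d [^] (n::nat) = \<one>" for d n
    using abelian_normal_torsion_free[OF fg D(1) comm nofin that] by auto
  interpret D: comm_group "G\<lparr>carrier := D\<rparr>" by (rule subgroup_comm_group[OF sD comm])
  obtain S where S: "finite S" "S \<subseteq> D" "generate (G\<lparr>carrier := D\<rparr>) S = D"
    by (rule subgroup_finitely_generated[OF fg sD])
  let ?P = "\<lambda>p. (\<lambda>d. d [^] (p::nat)) ` D"
  have "D \<subseteq> upper_central G (?P p) (card S)" if "nat_prime p" for p
    by (rule unipotent_hypercentral_mod_powers[OF D(1) comm S
          meta_nil_hamiltonian_unipotent[OF mnh fg D(1) comm tf] that])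
  then have "D \<subseteq> (\<Inter>p\<in>{p. nat_prime p}. upper_central G (?P p) (card S))" by blast
  also have "\<dots> \<subseteq> upper_central G (\<Inter>p\<in>{p. nat_prime p}. ?P p) (card S)"
    by (rule upper_central_Inter) (use two_is_prime_nat in blast)
  also have "\<dots> \<subseteq> upper_central G {\<one>} (card S)"
  proof (rule upper_central_mono, rule subsetI)
    fix x assume x: "x \<in> (\<Inter>p\<in>{p. nat_prime p}. ?P p)"
    then have root: "\<exists>y \<in> D. x = y [^] p" if "nat_prime p" for p using that by auto
    have "x \<in> D"
      using root[OF two_is_prime_nat] subgroup_nat_pow_closed[OF sD] by auto
    then show "x \<in> {\<one>}"
      using D.torsion_free_fg_not_divisible[OF all_subgroups_fg_subgroup[OF fg sD], of x] tf root
      by (simp flip: nat_pow_consistent)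
  qed
  finally have hyp: "D \<subseteq> upper_central G {\<one>} (card S)" .
  have one: "\<one> \<in> D" using subgroup.one_closed[OF sD] .
  \<comment> \<open>For \<open>z\<close> in the first term that meets \<open>D\<close> nontrivially,
    each [z,g] lies in \<open>D\<close> and in the preceding term, so it is trivial.\<close>
  define i where "i = (LEAST i. \<not> D \<inter> upper_central G {\<one>} i \<subseteq> {\<one>})"
  have i: "\<not> D \<inter> upper_central G {\<one>} i \<subseteq> {\<one>}"
    unfolding i_def by (rule LeastI[of _ "card S"]) (use hyp D(2) one in blast)
  then obtain j where j: "i = Suc j" by (cases i) auto
  have jN: "D \<inter> upper_central G {\<one>} j \<subseteq> {\<one>}"
    using not_less_Least[of j "\<lambda>i. \<not> D \<inter> upper_central G {\<one>} i \<subseteq> {\<one>}"] j by (auto simp: i_def)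
  obtain z where z: "z \<in> D" "z \<in> upper_central G {\<one>} (Suc j)" "z \<noteq> \<one>" using i j by auto
  have "cmtr G z g = \<one>" if "g \<in> carrier G" for g
    using z(2) that jN cmtr_mem_normal(1)[OF D(1) z(1) that] by auto
  then show ?thesis using z by auto
qed

lemma hypercentral_extension_nilpotent:
  assumes "M \<subseteq> upper_central G {\<one>} m" "upper_central G M n = carrier G"
  shows "nilpotent_group G"
proof -
  have "carrier G \<subseteq> upper_central G {\<one>} (m + n)"
    using upper_central_mono[OF assms(1), of n] assms(2) upper_central_add by simp
  then show ?thesis
    using nilpotent_iff_upper_central upper_central_subset_carrier[of "{\<one>}" "m + n"] by auto
qed

lemma no_finite_normal_contradiction:
  assumes mnh: "meta_nil_hamiltonian G" and fg: "all_subgroups_fg G" and vs: "virtually_solvable G"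
    and nn: "\<not> nilpotent_group G" and inf: "infinite (carrier G)"
    and nofin: "\<And>F. F \<lhd> G \<Longrightarrow> finite F \<Longrightarrow> F = {\<one>}"
    and quot: "\<And>M. M \<lhd> G \<Longrightarrow> M \<noteq> {\<one>} \<Longrightarrow>
      (\<exists>n. upper_central G M n = carrier G) \<or> finite_mod G M (derived G (carrier G))"
  shows False
proof -
  let ?G' = "derived G (carrier G)"
  obtain D where "D \<lhd> G" "D \<noteq> {\<one>}" "\<forall>u \<in> D. \<forall>v \<in> D. u \<otimes> v = v \<otimes> u"
    using exists_abelian_normal[OF vs inf] by auto
  then obtain z where z: "z \<in> D" "z \<noteq> \<one>" "\<And>g. g \<in> carrier G \<Longrightarrow> cmtr G z g = \<one>"
    using exists_central_element[OF mnh fg nofin, of D] by auto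
  have zc: "z \<in> carrier G" using z \<open>D \<lhd> G\<close> normal_mem_carrier by auto
  have zcomm: "z \<otimes> g = g \<otimes> z" if "g \<in> carrier G" for g using z(3) cmtr_eq_one_iff zc that by auto
  define Z where "Z = generate G {z}"
  have sZ: "subgroup Z G" unfolding Z_def using generate_is_subgroup[of "{z}"] zc by simp
  have Zcomm: "h \<otimes> g = g \<otimes> h" if "h \<in> Z" "g \<in> carrier G" for h g
    using central_generate_singleton[OF zc zcomm, of h g] that by (simp add: Z_def)
  have ZN: "Z \<lhd> G" using central_imp_normal[OF sZ Zcomm] .
  have "z \<in> Z" unfolding Z_def by (auto intro: generate.incl)
  have Z1: "Z \<subseteq> upper_central G {\<one>} 1"
    using Zcomm cmtr_eq_one_iff subgroup.mem_carrier[OF sZ] by auto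
  \<comment> \<open>\<open>Z\<close> is central, so a nilpotent quotient would make \<open>G\<close>
    nilpotent; the other alternative remains.\<close>
  have "finite_mod G Z ?G'"
    using quot[OF ZN] \<open>z \<in> Z\<close> z(2) hypercentral_extension_nilpotent[OF Z1] nn by auto
  then obtain F where F: "finite F" "F \<subseteq> carrier G" "?G' \<subseteq> Z <#> F" by (auto simp: finite_mod_def)
  \<comment> \<open>\<open>Z\<close> need not lie in \<open>?G'\<close>, and the transfer argument
    wants a normal subgroup in which \<open>Z\<close> has finite index.\<close>
  define P where "P = Z <#> ?G'"
  have G'N: "?G' \<lhd> G" by (rule derived_self_is_normal)
  have sG': "subgroup ?G' G" using G'N normal_imp_subgroup by auto
  have G'c: "x \<in> carrier G" if "x \<in> ?G'" for x using normal_mem_carrier[OF G'N that] .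
  have Zc: "x \<in> carrier G" if "x \<in> Z" for x using subgroup.mem_carrier[OF sZ that] .
  have PN: "P \<lhd> G" and ZP: "Z \<subseteq> P" and G'P: "?G' \<subseteq> P"
    unfolding P_def using set_mult_normal[OF ZN G'N] by auto
  have "P \<subseteq> Z <#> F"
  proof
    fix x assume "x \<in> P"
    then obtain a b where ab: "a \<in> Z" "b \<in> ?G'" "x = a \<otimes> b" by (auto simp: P_def set_mult_def)
    then obtain c f where cf: "c \<in> Z" "f \<in> F" "b = c \<otimes> f" using F(3) by (auto simp: set_mult_def)
    then have "x = (a \<otimes> c) \<otimes> f" using ab Zc F(2) by (auto simp: m_assoc)
    then show "x \<in> Z <#> F" using set_mult_memI[OF subgroup.m_closed[OF sZ ab(1) cf(1)] cf(2)] by simp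
  qed
  then have "finite (rcosets\<^bsub>G\<lparr>carrier := P\<rparr>\<^esub> Z)"
    using finite_mod_imp_finite_rcosets[OF _ sZ] F by (auto simp: finite_mod_def)
  then have cent: "p \<otimes> g = g \<otimes> p" if "p \<in> P" "g \<in> carrier G" for p g
    using virtually_central_normal_imp_central[OF PN sZ ZP Zcomm _ nofin that] by auto
  have "cmtr G x g \<in> upper_central G {\<one>} 1" if "x \<in> carrier G" "g \<in> carrier G" for x g
    using cmtr_mem_derived[OF that] G'P cent cmtr_eq_one_iff that by auto
  then have "upper_central G {\<one>} 2 = carrier G" by (auto simp: numeral_2_eq_2)
  then show False using nn nilpotent_iff_upper_central by auto
qed

end

subsection \<open>Finite normal subgroups with nilpotent quotient\<close>

context group
begin

lemma upper_central_cmtr_funpow: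
  assumes "g \<in> carrier G"
  shows "x \<in> upper_central G N n \<Longrightarrow> ((\<lambda>v. cmtr G v g) ^^ n) x \<in> N"
proof (induction n arbitrary: x)
  case (Suc n)
  then have "cmtr G x g \<in> upper_central G N n" using assms by auto
  then show ?case using Suc.IH by (simp only: funpow_Suc_right comp_apply)
qed simp

lemma int_pow_conj:
  assumes "g \<in> carrier G" "x \<in> carrier G"
  shows "(g \<otimes> x \<otimes> inv g) [^] (i::int) = g \<otimes> x [^] i \<otimes> inv g"
proof (cases i rule: int_cases2)
  case (nonneg n)
  then show ?thesis using conj_nat_pow[OF assms] by (simp add: int_pow_int)
next
  case (nonpos n)
  then show ?thesis using conj_nat_pow[OF assms] assms by (simp add: int_pow_neg int_pow_int word_simps)
qed

text \<open>If \<open>y\<close> acts on the infinite cyclic group <a> by a -> a^j, then n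
  commutations with \<open>y\<close> turn \<open>a\<close> into a^((1-j)^n), which is trivial only
  for j = 1.\<close>

lemma normal_cyclic_central:
  assumes a: "a \<in> carrier G" and y: "y \<in> carrier G" and j: "y \<otimes> a \<otimes> inv y = a [^] (j::int)"
    and nil: "((\<lambda>v. cmtr G v y) ^^ n) a = \<one>"
    and tf: "\<And>i::int. a [^] i = \<one> \<Longrightarrow> i = 0"
  shows "cmtr G a y = \<one>"
proof -
  have step: "cmtr G (a [^] i) y = a [^] (i * (1 - j))" for i :: int
  proof -
    have "cmtr G (a [^] i) y = a [^] i \<otimes> inv (y \<otimes> a [^] i \<otimes> inv y)"
      using a y by (simp add: cmtr_def word_simps)
    also have "y \<otimes> a [^] i \<otimes> inv y = a [^] (j * i)"
      using int_pow_conj[OF y a, of i] j a by (simp add: int_pow_pow)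
    finally show ?thesis using a by (simp add: right_diff_distrib int_pow_diff mult.commute)
  qed
  have "((\<lambda>v. cmtr G v y) ^^ k) a = a [^] ((1 - j) ^ k)" for k
    by (induction k) (use a step in \<open>auto simp: mult.commute\<close>)
  then have "(1 - j) ^ n = 0" using nil tf by metis
  then have "j = 1" by simp
  then show ?thesis using step[of 1] a by simp
qed

lemma finite_normal_nilpotent_quotient:
  assumes mnh: "meta_nil_hamiltonian G" and nn: "\<not> nilpotent_group G"
    and T: "T \<lhd> G" "finite T" and Tmax: "\<And>F. F \<lhd> G \<Longrightarrow> finite F \<Longrightarrow> F \<subseteq> T"
    and nilT: "upper_central G T n = carrier G"
  shows "derived G (carrier G) \<subseteq> T"
proof -
  let ?Q = "G Mod T" and ?h = "\<lambda>x. T #> x"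
  interpret h: group_hom G ?Q ?h by (rule FactGroup_group_hom[OF T(1)])
  have sT: "subgroup T G" using T normal_imp_subgroup by auto
  have Tc: "v \<in> carrier G" if "v \<in> T" for v using that normal_mem_carrier[OF T(1)] by auto
  have surj: "?h ` carrier G = carrier ?Q" by (simp add: carrier_FactGroup)
  have iff: "?h x = \<one>\<^bsub>?Q\<^esub> \<longleftrightarrow> x \<in> T" if "x \<in> carrier G" for x
    using r_coset_eq_iff_mem[OF sT that] by simp
  define H where "H g = T <#> generate G {g}" for g
  have sH: "subgroup (H g) G" if "g \<in> carrier G" for g
    unfolding H_def using mult_norm_subgroup[OF T(1)] generate_is_subgroup[of "{g}"] that by auto
  have gH: "g \<in> H g" if "g \<in> carrier G" for g
    unfolding H_def
    using set_mult_memI[OF subgroup.one_closed[OF sT] generate.incl[of g "{g}" G]] that by simp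
  have TH: "T \<subseteq> H g" for g
    unfolding H_def using set_mult_memI[OF _ generate.one[of G "{g}"], of _ T] Tc by fastforce
  \<comment> \<open>A non-nilpotent T<g> is normal, so <g> is normal modulo \<open>T\<close>. If
    \<open>g\<close> has finite order modulo \<open>T\<close>, then T<g> is finite and lies in
    \<open>T\<close> by maximality; otherwise <g> is infinite cyclic modulo \<open>T\<close>, and
    the nilpotent quotient can only centralize it.\<close>
  have central: "cmtr G g x \<in> T"
    if g: "g \<in> carrier G" and x: "x \<in> carrier G" and nonnil: "\<not> nilpotent_group (G\<lparr>carrier := H g\<rparr>)" for g x
  proof -
    have HN: "H g \<lhd> G" using mnh sH[OF g] nonnil by (auto simp: meta_nil_hamiltonian_def)
    show ?thesis
    proof (cases "\<exists>m::nat. m \<noteq> 0 \<and> g [^] m \<in> T")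
      case True
      then obtain m where m: "m \<noteq> (0::nat)" "g [^] m \<in> T" by auto
      have "H g \<subseteq> T <#> ((\<lambda>i. g [^] i) ` {..<m})"
      proof
        fix y assume "y \<in> H g"
        then obtain t k where t: "t \<in> T" "y = t \<otimes> g [^] (k::int)"
          using generate_pow[OF g] by (auto simp: H_def set_mult_def)
        define i where "i = nat (k mod int m)"
        have "k = int m * (k div int m) + int i" using m by (simp add: i_def)
        then have "g [^] k = (g [^] m) [^] (k div int m) \<otimes> g [^] i"
          using g by (metis int_pow_mult int_pow_pow int_pow_int)
        moreover have "(g [^] m) [^] (k div int m) \<in> T" by (rule subgroup_int_pow_closed[OF sT m(2)])
        moreover have "i < m" using m by (simp add: i_def nat_less_iff)
        ultimately have "y = (t \<otimes> (g [^] m) [^] (k div int m)) \<otimes> g [^] i"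
          "t \<otimes> (g [^] m) [^] (k div int m) \<in> T" "g [^] i \<in> (\<lambda>i. g [^] i) ` {..<m}"
          using t g Tc subgroup.m_closed[OF sT] by (auto simp: m_assoc)
        then show "y \<in> T <#> ((\<lambda>i. g [^] i) ` {..<m})" using set_mult_memI by auto
      qed
      moreover have "finite (T <#> ((\<lambda>i. g [^] i) ` {..<m}))" using T(2) by (auto simp: set_mult_def)
      ultimately have "finite (H g)" using finite_subset by auto
      then have "g \<in> T" using Tmax[OF HN] gH[OF g] by auto
      then show ?thesis using cmtr_mem_normal(1)[OF T(1) _ x] by auto
    next
      case False
      have tf: "i = 0" if "?h g [^]\<^bsub>?Q\<^esub> (i::int) = \<one>\<^bsub>?Q\<^esub>" for i
      proof -
        have "g [^] i \<in> T" using that h.hom_int_pow[OF g, of i] iff g by (metis int_pow_closed)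
        moreover from this have "inv (g [^] i) \<in> T" by (rule subgroup.m_inv_closed[OF sT])
        ultimately have "g [^] nat \<bar>i\<bar> \<in> T"
          using g by (cases i rule: int_cases2) (auto simp: int_pow_neg int_pow_int)
        then show ?thesis using False by (metis abs_eq_0 nat_0_iff abs_ge_zero order_antisym)
      qed
      have "x \<otimes> g \<otimes> inv x \<in> H g" using conj_closed[OF HN x gH[OF g]] .
      then obtain t and k :: int where t: "t \<in> T" "x \<otimes> g \<otimes> inv x = t \<otimes> g [^] k"
        using generate_pow[OF g] by (auto simp: H_def set_mult_def)
      have "?h x \<otimes>\<^bsub>?Q\<^esub> ?h g \<otimes>\<^bsub>?Q\<^esub> inv\<^bsub>?Q\<^esub> ?h x = ?h (x \<otimes> g \<otimes> inv x)"
        using g x by (simp only: h.hom_mult h.hom_inv m_closed inv_closed)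
      also have "\<dots> = ?h t \<otimes>\<^bsub>?Q\<^esub> ?h (g [^] k)" unfolding t(2) using t(1) Tc g by (simp only: h.hom_mult int_pow_closed)
      also have "\<dots> = ?h g [^]\<^bsub>?Q\<^esub> k"
        using iff[OF Tc[OF t(1)]] t(1) h.hom_int_pow[OF g, of k] h.hom_closed[OF g]
        by (metis h.H.l_one h.H.int_pow_closed)
      finally have conj: "?h x \<otimes>\<^bsub>?Q\<^esub> ?h g \<otimes>\<^bsub>?Q\<^esub> inv\<^bsub>?Q\<^esub> ?h x = ?h g [^]\<^bsub>?Q\<^esub> k" .
      have "((\<lambda>v. cmtr G v x) ^^ n) g \<in> T" using upper_central_cmtr_funpow[OF x] nilT g by auto
      then have "((\<lambda>v. cmtr ?Q v (?h x)) ^^ n) (?h g) = \<one>\<^bsub>?Q\<^esub>"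
        using h.cmtr_funpow_img[OF x g, of n] iff by metis
      from h.H.normal_cyclic_central[OF h.hom_closed[OF g] h.hom_closed[OF x] conj this tf]
      have "cmtr ?Q (?h g) (?h x) = \<one>\<^bsub>?Q\<^esub>" .
      then show ?thesis using h.cmtr_img[OF g x] iff[OF cmtr_closed[OF g x]] by simp
    qed
  qed
  show ?thesis
  proof (cases "nilpotent_group (G\<lparr>carrier := T\<rparr>)")
    case False
    then have "\<not> nilpotent_group (G\<lparr>carrier := H g\<rparr>)" if "g \<in> carrier G" for g
      using nilpotent_subgroup[OF sT sH[OF that] TH] by auto
    then show ?thesis using derived_subset_iff[OF sT] central by auto
  next
    case True
    \<comment> \<open>If all elements acted nilpotently on the nilpotent \<open>T\<close>, it would
      be hypercentral, and \<open>G\<close> with its nilpotent quotient would be nilpotent.\<close>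
    have "\<not> T \<subseteq> upper_central G {\<one>} m" for m
      using hypercentral_extension_nilpotent[OF _ nilT] nn by auto
    then obtain g0 where g0: "g0 \<in> carrier G"
      and act: "\<And>k. \<exists>v \<in> T. ((\<lambda>v. cmtr G v g0) ^^ k) v \<noteq> \<one>"
      using finite_nilpotent_hypercentral[OF T True] by blast
    define C where "C = {c \<in> carrier G. \<forall>v \<in> T. c \<otimes> v = v \<otimes> c}"
    have nonnil: "\<not> nilpotent_group (G\<lparr>carrier := H (g0 \<otimes> c)\<rparr>)" if c: "c \<in> C" for c
    proof
      have cc: "c \<in> carrier G" using c by (auto simp: C_def)
      have gc: "g0 \<otimes> c \<in> carrier G" using g0 cc by simp
      assume "nilpotent_group (G\<lparr>carrier := H (g0 \<otimes> c)\<rparr>)"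
      then obtain k where k: "\<forall>v \<in> T. ((\<lambda>v. cmtr G v (g0 \<otimes> c)) ^^ k) v = \<one>"
        using nilpotent_cmtr_funpow[OF sH[OF gc]] TH gH[OF gc] by blast
      \<comment> \<open>\<open>c\<close> centralizes \<open>T\<close> and drops out, so
        \<open>g0 \<otimes> c\<close> is as far from acting nilpotently on \<open>T\<close> as
        \<open>g0\<close> is.\<close>
      have eq: "cmtr G v (g0 \<otimes> c) = cmtr G v g0" if v: "v \<in> T" for v
      proof -
        have iv: "inv v \<in> T" using subgroup.m_inv_closed[OF sT v] .
        have "cmtr G v (g0 \<otimes> c) = v \<otimes> g0 \<otimes> (c \<otimes> inv v) \<otimes> inv c \<otimes> inv g0"
          using Tc[OF v] g0 cc by (simp add: cmtr_def word_simps)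
        also have "c \<otimes> inv v = inv v \<otimes> c" using c iv by (auto simp: C_def)
        finally show ?thesis using Tc[OF v] g0 cc by (simp add: cmtr_def word_simps)
      qed
      have "v \<in> T \<Longrightarrow> ((\<lambda>v. cmtr G v g0) ^^ i) v \<in> T \<and>
          ((\<lambda>v. cmtr G v g0) ^^ i) v = ((\<lambda>v. cmtr G v (g0 \<otimes> c)) ^^ i) v" for i v
        by (induction i) (use eq cmtr_mem_normal(1)[OF T(1) _ g0] in auto)
      then show False using k act by metis
    qed
    define Z where "Z = {x \<in> carrier G. \<forall>g \<in> carrier G. cmtr G x g \<in> T}"
    have ZN: "Z \<lhd> G" unfolding Z_def by (rule relative_center_normal[OF T(1) normal_self])
    have sZ: "subgroup Z G" using ZN normal_imp_subgroup by auto
    have sC: "subgroup C G"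
    proof (rule subgroupI)
      show "C \<noteq> {}" using Tc by (auto simp: C_def intro!: exI[of _ \<one>])
      fix a assume a: "a \<in> C"
      have ac: "a \<in> carrier G" using a by (auto simp: C_def)
      have "inv a \<otimes> v = v \<otimes> inv a" if v: "v \<in> T" for v
      proof -
        have "inv a \<otimes> (v \<otimes> a) \<otimes> inv a = inv a \<otimes> (a \<otimes> v) \<otimes> inv a" using a v by (auto simp: C_def)
        then show ?thesis using ac Tc[OF v] by (simp add: word_simps)
      qed
      then show "inv a \<in> C" using ac by (auto simp: C_def)
      fix b assume b: "b \<in> C"
      have bc: "b \<in> carrier G" using b by (auto simp: C_def)
      have "a \<otimes> b \<otimes> v = v \<otimes> (a \<otimes> b)" if v: "v \<in> T" for v
      proof -
        have "a \<otimes> b \<otimes> v = a \<otimes> (b \<otimes> v)" using ac bc Tc[OF v] by (simp add: m_assoc)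
        also have "\<dots> = (a \<otimes> v) \<otimes> b" using b v ac bc Tc[OF v] by (auto simp: C_def m_assoc)
        also have "\<dots> = v \<otimes> (a \<otimes> b)" using a v ac bc Tc[OF v] by (auto simp: C_def m_assoc)
        finally show ?thesis .
      qed
      then show "a \<otimes> b \<in> C" using ac bc by (auto simp: C_def)
    qed (auto simp: C_def)
    have CZ: "C \<subseteq> Z"
    proof
      fix c assume c: "c \<in> C"
      have cc: "c \<in> carrier G" using c by (auto simp: C_def)
      \<comment> \<open>Both \<open>g0 \<otimes> c\<close> and, taking the identity for
        \<open>c\<close>, \<open>g0\<close> itself are central modulo \<open>T\<close>; hence so is
        \<open>c\<close>.\<close>
      have "g0 \<otimes> c \<in> Z" using central[OF _ _ nonnil[OF c]] g0 cc by (auto simp: Z_def)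
      moreover have "\<one> \<in> C" using subgroup.one_closed[OF sC] .
      then have "g0 \<in> Z" using central[OF _ _ nonnil, of \<one>] g0 by (auto simp: Z_def)
      ultimately have "inv g0 \<otimes> (g0 \<otimes> c) \<in> Z"
        using subgroup.m_closed[OF sZ] subgroup.m_inv_closed[OF sZ] by auto
      then show "c \<in> Z" using g0 cc by (simp add: word_simps)
    qed
    have "finite_mod G C (carrier G)"
    proof (rule finite_mod_fibres[OF sC subset_refl])
      \<comment> \<open>Conjugation by \<open>inv g\<close>, not by \<open>g\<close>: equal values
        then say that \<open>g \<otimes> inv g'\<close> centralizes \<open>T\<close>, which is the
        right coset condition required.\<close>
      let ?f = "\<lambda>g. \<lambda>v\<in>T. inv g \<otimes> v \<otimes> g"
      have "?f ` carrier G \<subseteq> T \<rightarrow>\<^sub>E T"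
        using conj_closed[OF T(1), of "inv _"] by fastforce
      then show "finite (?f ` carrier G)" using finite_PiE[OF T(2), of "\<lambda>_. T"] T(2) finite_subset by auto
      fix g g' assume g: "g \<in> carrier G" "g' \<in> carrier G" and eq: "?f g = ?f g'"
      have "g \<otimes> inv g' \<otimes> v = v \<otimes> (g \<otimes> inv g')" if v: "v \<in> T" for v
      proof -
        have "inv g \<otimes> v \<otimes> g = inv g' \<otimes> v \<otimes> g'" using fun_cong[OF eq, of v] v by simp
        then have "g \<otimes> (inv g \<otimes> v \<otimes> g) \<otimes> inv g' = g \<otimes> (inv g' \<otimes> v \<otimes> g') \<otimes> inv g'" by simp
        then show ?thesis using g Tc[OF v] by (simp add: word_simps)
      qed
      then show "g \<otimes> inv g' \<in> C" using g by (auto simp: C_def)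
    qed
    then have "finite_mod G Z (carrier G)" using finite_mod_mono CZ by auto
    from h.finite_mod_img[OF this subgroup.subset[OF sZ]]
    have "finite_mod ?Q (?h ` Z) (carrier ?Q)" unfolding surj .
    moreover have hZ: "subgroup (?h ` Z) ?Q" using h.subgroup_img_is_subgroup[OF sZ] .
    ultimately have fin: "finite (rcosets\<^bsub>?Q\<lparr>carrier := carrier ?Q\<rparr>\<^esub> (?h ` Z))"
      by (rule h.H.finite_mod_imp_finite_rcosets)
    have cent: "a \<otimes>\<^bsub>?Q\<^esub> b = b \<otimes>\<^bsub>?Q\<^esub> a" if a: "a \<in> ?h ` Z" and b: "b \<in> carrier ?Q" for a b
    proof -
      obtain x where x: "x \<in> Z" "a = ?h x" using a by auto
      obtain y where y: "y \<in> carrier G" "b = ?h y" using b surj by auto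
      have xc: "x \<in> carrier G" using x by (auto simp: Z_def)
      have "cmtr ?Q a b = \<one>\<^bsub>?Q\<^esub>"
        using x y h.cmtr_img[OF xc y(1)] iff[OF cmtr_closed[OF xc y(1)]] by (auto simp: Z_def)
      then show ?thesis using h.H.cmtr_eq_one_iff[OF h.hom_closed[OF xc] h.hom_closed[OF y(1)]] x y by blast
    qed
    \<comment> \<open>A finite normal subgroup of the quotient has a finite preimage, since
      \<open>T\<close> is finite, and so lies in the largest one.\<close>
    have nofin: "K = {\<one>\<^bsub>?Q\<^esub>}" if K: "K \<lhd> ?Q" "finite K" for K
    proof -
      let ?K = "{x \<in> carrier G. ?h x \<in> K}"
      have "finite Y" if Y: "Y \<in> K" for Y
      proof -
        have "Y \<in> ?h ` carrier G" using Y h.H.normal_mem_carrier[OF K(1)] surj by auto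
        then show ?thesis using T(2) by (auto simp: r_coset_def)
      qed
      then have "finite (\<Union>K)" using K(2) by auto
      moreover have "?K \<subseteq> \<Union>K" using rcos_self[OF _ sT] by blast
      ultimately have "?K \<subseteq> T" using Tmax[OF h.normal_preimage[OF K(1)]] finite_subset by blast
      have "K \<subseteq> {\<one>\<^bsub>?Q\<^esub>}"
      proof
        fix k assume k: "k \<in> K"
        then have "k \<in> ?h ` carrier G" using h.H.normal_mem_carrier[OF K(1)] surj by auto
        then obtain x where x: "x \<in> carrier G" "k = ?h x" by auto
        then have "x \<in> T" using k \<open>?K \<subseteq> T\<close> by auto
        then show "k \<in> {\<one>\<^bsub>?Q\<^esub>}" using iff[OF x(1)] x(2) by simp
      qed
      then show ?thesis using subgroup.one_closed[OF normal_imp_subgroup[OF K(1)]] by blast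
    qed
    have "cmtr G x y \<in> T" if x: "x \<in> carrier G" and y: "y \<in> carrier G" for x y
    proof -
      \<comment> \<open>Here the whole quotient plays the role of \<open>P\<close>: a
        centre-by-finite group without finite normal subgroups is abelian.\<close>
      have "?h x \<otimes>\<^bsub>?Q\<^esub> ?h y = ?h y \<otimes>\<^bsub>?Q\<^esub> ?h x"
        by (rule h.H.virtually_central_normal_imp_central[OF h.H.normal_self hZ _ cent fin nofin])
          (use surj subgroup.subset[OF hZ] x y h.hom_closed in auto)
      then have "cmtr ?Q (?h x) (?h y) = \<one>\<^bsub>?Q\<^esub>"
        using h.H.cmtr_eq_one_iff[OF h.hom_closed[OF x] h.hom_closed[OF y]] by blast
      then show ?thesis using h.cmtr_img[OF x y] iff[OF cmtr_closed[OF x y]] by simp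
    qed
    then show ?thesis using derived_subset_iff[OF sT] by auto
  qed
qed

end

subsection \<open>Finiteness of the derived subgroup\<close>

context group_hom
begin

lemma image_preimage:
  assumes "h ` carrier G = carrier H" "K \<subseteq> carrier H"
  shows "h ` {x \<in> carrier G. h x \<in> K} = K"
proof
  show "K \<subseteq> h ` {x \<in> carrier G. h x \<in> K}"
  proof
    fix k assume k: "k \<in> K"
    then obtain x where "x \<in> carrier G" "k = h x" using assms by blast
    then show "k \<in> h ` {x \<in> carrier G. h x \<in> K}" using k by auto
  qed
qed auto

lemma all_subgroups_fg_img:
  assumes surj: "h ` carrier G = carrier H" and fg: "all_subgroups_fg G"
  shows "all_subgroups_fg H"
  unfolding all_subgroups_fg_def
proof (intro allI impI)
  fix K assume K: "subgroup K H"
  let ?K = "{x \<in> carrier G. h x \<in> K}"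
  obtain S where S: "finite S" "S \<subseteq> carrier G" "?K = generate G S"
    using subgroup_preimage[OF K] fg unfolding all_subgroups_fg_def by blast
  have "generate H (h ` S) = K"
    using generate_img[OF S(2)] S(3) image_preimage[OF surj subgroup.subset[OF K]] by simp
  then show "\<exists>S. finite S \<and> S \<subseteq> carrier H \<and> K = generate H S"
    using S by (intro exI[of _ "h ` S"]) auto
qed

text \<open>The preimage of a non-nilpotent subgroup is non-nilpotent, hence normal, and normality
  passes to images.\<close>

lemma meta_nil_hamiltonian_img:
  assumes surj: "h ` carrier G = carrier H" and mnh: "meta_nil_hamiltonian G"
  shows "meta_nil_hamiltonian H"
  unfolding meta_nil_hamiltonian_def
proof (intro allI impI)
  fix K assume K: "subgroup K H \<and> \<not> nilpotent_group (H\<lparr>carrier := K\<rparr>)"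
  let ?K = "{x \<in> carrier G. h x \<in> K}"
  have sK: "subgroup ?K G" using subgroup_preimage K by auto
  have img: "h ` ?K = K" using image_preimage[OF surj subgroup.subset] K by blast
  interpret r: group_hom "G\<lparr>carrier := ?K\<rparr>" "H\<lparr>carrier := K\<rparr>" h
    using induced_group_hom[OF sK] img by simp
  have "\<not> nilpotent_group (G\<lparr>carrier := ?K\<rparr>)" using r.nilpotent_img img K by auto
  then have "?K \<lhd> G" using mnh sK by (auto simp: meta_nil_hamiltonian_def)
  then show "K \<lhd> H" using normal_img[OF surj] img by metis
qed

lemma virtually_solvable_img:
  assumes surj: "h ` carrier G = carrier H" and vs: "virtually_solvable G"
  shows "virtually_solvable H"
proof -
  obtain N n where N: "N \<lhd> G" "finite_mod G N (carrier G)" "(derived G ^^ n) N = {\<one>\<^bsub>G\<^esub>}"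
    using vs by (auto simp: virtually_solvable_def)
  have Nc: "N \<subseteq> carrier G" using G.normal_mem_carrier[OF N(1)] by auto
  have "finite_mod H (h ` N) (carrier H)" using finite_mod_img[OF N(2) Nc] surj by simp
  moreover have "(derived H ^^ n) (h ` N) = {\<one>\<^bsub>H\<^esub>}" using exp_of_derived_img[OF Nc, of n] N(3) by simp
  ultimately show ?thesis using normal_img[OF surj N(1)] by (auto simp: virtually_solvable_def)
qed

text \<open>Counterpart of \<open>upper_central_img\<close>, for pulling nilpotency of a quotient
  back to a series in \<open>G\<close>.\<close>

lemma upper_central_preimage:
  "x \<in> carrier G \<Longrightarrow> h x \<in> upper_central H M n \<Longrightarrow>
     x \<in> upper_central G {y \<in> carrier G. h y \<in> M} n"
proof (induction n arbitrary: x)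
  case (Suc n)
  have "cmtr G x g \<in> upper_central G {y \<in> carrier G. h y \<in> M} n" if g: "g \<in> carrier G" for g
    using Suc.IH[of "cmtr G x g"] Suc.prems g by (simp add: cmtr_img)
  then show ?case using Suc.prems by simp
qed simp

end

context group
begin

theorem meta_nil_hamiltonian_derived_finite:
  assumes mnh: "meta_nil_hamiltonian G" and fg: "all_subgroups_fg G" and vs: "virtually_solvable G"
    and nn: "\<not> nilpotent_group G"
  shows "finite (derived G (carrier G))"
proof (rule ccontr)
  assume inf: "infinite (derived G (carrier G))"
  let ?G' = "derived G (carrier G)"
  \<comment> \<open>The normal subgroups whose quotient is neither nilpotent nor has finite derived
    subgroup, expressed inside \<open>G\<close> so that the maximal condition applies.\<close>
  define \<F> where "\<F> = {N. N \<lhd> G \<and> (\<forall>n. upper_central G N n \<noteq> carrier G) \<and> \<not> finite_mod G N ?G'}"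
  have "{\<one>} \<in> \<F>"
    using one_is_normal nn nilpotent_iff_upper_central finite_mod_finite inf by (auto simp: \<F>_def)
  then have "\<exists>N \<in> \<F>. \<forall>M \<in> \<F>. N \<subseteq> M \<longrightarrow> M = N"
    by (intro all_subgroups_fg_maximal[OF fg]) (auto simp: \<F>_def normal_imp_subgroup)
  then obtain N where NF: "N \<in> \<F>" and max: "\<And>M. M \<in> \<F> \<Longrightarrow> N \<subseteq> M \<Longrightarrow> M = N" by blast
  have N: "N \<lhd> G" using NF by (auto simp: \<F>_def)
  have sN: "subgroup N G" using N normal_imp_subgroup by auto
  let ?Q = "G Mod N" and ?h = "\<lambda>x. N #> x"
  interpret h: group_hom G ?Q ?h by (rule FactGroup_group_hom[OF N])
  have surj: "?h ` carrier G = carrier ?Q" by (simp add: carrier_FactGroup)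
  have iff: "?h x = \<one>\<^bsub>?Q\<^esub> \<longleftrightarrow> x \<in> N" if "x \<in> carrier G" for x
    using r_coset_eq_iff_mem[OF sN that] by simp
  let ?Q' = "derived ?Q (carrier ?Q)"
  have Q': "?Q' = ?h ` ?G'" using h.derived_img[of "carrier G"] surj by simp
  have mnhQ: "meta_nil_hamiltonian ?Q" by (rule h.meta_nil_hamiltonian_img[OF surj mnh])
  have fgQ: "all_subgroups_fg ?Q" by (rule h.all_subgroups_fg_img[OF surj fg])
  have vsQ: "virtually_solvable ?Q" by (rule h.virtually_solvable_img[OF surj vs])
  have nnQ: "\<not> nilpotent_group ?Q"
  proof
    assume "nilpotent_group ?Q"
    then obtain n where n: "upper_central ?Q {\<one>\<^bsub>?Q\<^esub>} n = carrier ?Q"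
      using h.H.nilpotent_iff_upper_central by auto
    have eq: "{y \<in> carrier G. ?h y \<in> {\<one>\<^bsub>?Q\<^esub>}} = N"
      using iff normal_mem_carrier[OF N] by blast
    have "x \<in> upper_central G N n" if "x \<in> carrier G" for x
      using h.upper_central_preimage[OF that, of "{\<one>\<^bsub>?Q\<^esub>}" n] h.hom_closed[OF that] n eq by metis
    then have "upper_central G N n = carrier G"
      using upper_central_subset_carrier[OF subgroup.subset[OF sN]] by blast
    then show False using NF by (auto simp: \<F>_def)
  qed
  have infQ: "infinite ?Q'"
  proof
    assume "finite ?Q'"
    then have "finite_mod G N ?G'"
    proof (intro finite_mod_fibres[OF sN, of _ ?h])
      show "?G' \<subseteq> carrier G" using derived_in_carrier by auto
      show "g \<otimes> inv g' \<in> N" if "g \<in> ?G'" "g' \<in> ?G'" "N #> g = N #> g'" for g g'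
        using that rcos_self[OF _ sN] derived_in_carrier[of "carrier G"]
          subgroup.rcos_module_imp[OF sN is_group] by blast
    qed (simp add: Q')
    then show False using NF by (auto simp: \<F>_def)
  qed
  have quot: "(\<exists>n. upper_central ?Q M n = carrier ?Q) \<or> finite_mod ?Q M ?Q'"
    if M: "M \<lhd> ?Q" "M \<noteq> {\<one>\<^bsub>?Q\<^esub>}" for M
  proof -
    let ?M = "{x \<in> carrier G. ?h x \<in> M}"
    have sM: "subgroup M ?Q" using M normal_imp_subgroup by auto
    have MN: "?M \<lhd> G" by (rule h.normal_preimage[OF M(1)])
    have img: "?h ` ?M = M" by (rule h.image_preimage[OF surj subgroup.subset[OF sM]])
    have sub: "N \<subseteq> ?M"
    proof
      fix x assume "x \<in> N"
      then show "x \<in> ?M"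
        using iff normal_mem_carrier[OF N] subgroup.one_closed[OF sM] by (metis (mono_tags, lifting) mem_Collect_eq)
    qed
    have "?M \<noteq> N"
    proof
      assume "?M = N"
      then have "M = ?h ` N" using img by simp
      then have "M \<subseteq> {\<one>\<^bsub>?Q\<^esub>}" using iff normal_mem_carrier[OF N] by auto
      then show False using M(2) subgroup.one_closed[OF sM] by blast
    qed
    then have "?M \<notin> \<F>" using max[OF _ sub] by blast
    then consider n where "upper_central G ?M n = carrier G" | "finite_mod G ?M ?G'"
      using MN by (auto simp: \<F>_def)
    then show ?thesis
    proof cases
      case 1
      have "?h ` upper_central G ?M n \<subseteq> upper_central ?Q M n"
        by (rule h.upper_central_img[OF surj]) auto
      then have "upper_central ?Q M n = carrier ?Q"
        using 1 surj h.H.upper_central_subset_carrier[OF subgroup.subset[OF sM]] by (metis subset_antisym)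
      then show ?thesis by blast
    next
      case 2
      then show ?thesis using h.finite_mod_img[OF 2] img Q' by auto
    qed
  qed
  define \<T> where "\<T> = {F. F \<lhd> ?Q \<and> finite F}"
  have "\<exists>T \<in> \<T>. \<forall>F \<in> \<T>. T \<subseteq> F \<longrightarrow> F = T"
  proof (rule h.H.all_subgroups_fg_maximal[OF fgQ])
    show "\<T> \<noteq> {}" using h.H.one_is_normal by (auto simp: \<T>_def)
  qed (auto simp: \<T>_def normal_imp_subgroup)
  then obtain T where T: "T \<lhd> ?Q" "finite T"
    and Tm: "\<And>F. F \<lhd> ?Q \<Longrightarrow> finite F \<Longrightarrow> T \<subseteq> F \<Longrightarrow> F = T" by (auto simp: \<T>_def)
  \<comment> \<open>Products of finite normal subgroups are finite and normal, so a maximal one is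
    the largest.\<close>
  have Tmax: "F \<subseteq> T" if F: "F \<lhd> ?Q" "finite F" for F
  proof -
    have "finite (T <#>\<^bsub>?Q\<^esub> F)" using T(2) F(2) unfolding set_mult_def by auto
    then show ?thesis using Tm h.H.set_mult_normal[OF T(1) F(1)] by metis
  qed
  show False
  proof (cases "T = {\<one>\<^bsub>?Q\<^esub>}")
    case True
    have nofin: "F = {\<one>\<^bsub>?Q\<^esub>}" if "F \<lhd> ?Q" "finite F" for F
      using Tmax[OF that] True subgroup.one_closed[OF normal_imp_subgroup[OF that(1)]] by blast
    have "infinite (carrier ?Q)"
      using infQ h.H.derived_in_carrier[of "carrier ?Q"] finite_subset by blast
    from h.H.no_finite_normal_contradiction[OF mnhQ fgQ vsQ nnQ this nofin quot] show False .
  next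
    case False
    \<comment> \<open>The second alternative would make \<open>?Q'\<close> finite at once, as it is
      finite modulo a finite subgroup.\<close>
    then consider n where "upper_central ?Q T n = carrier ?Q" | "finite_mod ?Q T ?Q'"
      using quot[OF T(1)] by blast
    then show False
    proof cases
      case 1
      have "?Q' \<subseteq> T" by (rule h.H.finite_normal_nilpotent_quotient[OF mnhQ nnQ T Tmax 1])
      then show False using infQ T(2) finite_subset by blast
    next
      case 2
      then show False using h.H.finite_mod_finite T(2) infQ by blast
    qed
  qed
qed

end

subsection \<open>Polycyclic-by-finite groups\<close>

context group
begin

lemma polycyclic_seq_imp_solvable_seq: "polycyclic_seq G H \<Longrightarrow> solvable_seq G H"
proof (induction rule: polycyclic_seq.induct)
  case (extension K H)
  have "group ((G\<lparr>carrier := H\<rparr>) Mod K)" using extension(2) by (rule normal.factorgroup_is_group)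
  then show ?case
    using extension solvable_seq.extension group.cyclic_imp_abelian_group by blast
qed (rule solvable_seq.unity)

text \<open>\<open>U\<close> modulo \<open>U \<inter> K\<close> embeds into a cyclic group, so one
  more generator \<open>w\<close> is enough, with the least positive exponent of \<open>c\<close>
  that occurs.\<close>

lemma cyclic_extension_subgroup_fg:
  assumes K: "K \<lhd> G\<lparr>carrier := H\<rparr>" and H: "subgroup H G" and cyc: "cyclic_group ((G\<lparr>carrier := H\<rparr>) Mod K)"
    and U: "subgroup U G" "U \<subseteq> H" and S: "finite S" "S \<subseteq> carrier G" "U \<inter> K = generate G S"
  shows "\<exists>S. finite S \<and> S \<subseteq> carrier G \<and> U = generate G S"
proof -
  let ?H = "G\<lparr>carrier := H\<rparr>"
  let ?Q = "?H Mod K"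
  interpret H: group ?H using H subgroup_imp_group by auto
  interpret h: group_hom ?H ?Q "\<lambda>x. K #> x" using H.FactGroup_group_hom[OF K] by simp
  have sK: "subgroup K ?H" using K normal_imp_subgroup by auto
  have Uc: "u \<in> carrier G" if "u \<in> U" for u using subgroup.mem_carrier[OF U(1) that] .
  obtain c where c: "c \<in> carrier ?Q" "carrier ?Q = range (\<lambda>n::int. c [^]\<^bsub>?Q\<^esub> n)"
    using cyc h.H.cyclic_group by auto
  have deg: "\<exists>n::int. K #> u = c [^]\<^bsub>?Q\<^esub> n" if "u \<in> U" for u
    using h.hom_closed[of u] c(2) that U(2) by auto
  have hm: "K #> (u \<otimes> v) = (K #> u) \<otimes>\<^bsub>?Q\<^esub> (K #> v)" if "u \<in> U" "v \<in> U" for u v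
    using h.hom_mult[of u v] that U(2) by auto
  have hp: "K #> (u [^] n) = (K #> u) [^]\<^bsub>?Q\<^esub> (n::int)" if "u \<in> U" for u n
    using h.hom_int_pow[of u n] int_pow_consistent[OF H, of u n] that U(2) by auto
  have memK: "u \<in> K" if "u \<in> U" "K #> u = c [^]\<^bsub>?Q\<^esub> (0::int)" for u
    using H.r_coset_eq_iff_mem[OF sK, of u] that U(2) by auto
  show ?thesis
  \<comment> \<open>If \<open>c\<close> has finite order, exponents are not determined by
    \<open>u\<close>; the case split and the division below ask only for some exponent.\<close>
  proof (cases "\<exists>d::nat. 0 < d \<and> (\<exists>u \<in> U. K #> u = c [^]\<^bsub>?Q\<^esub> int d)")
    case False
    have "U \<subseteq> K"
    proof
      fix u assume u: "u \<in> U"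
      obtain n :: int where n: "K #> u = c [^]\<^bsub>?Q\<^esub> n" using deg[OF u] by auto
      have "n = 0"
      proof (rule ccontr)
        assume "n \<noteq> 0"
        show False
        proof (cases "n > 0")
          case True
          then have "K #> u = c [^]\<^bsub>?Q\<^esub> int (nat n)" using n by simp
          then show False using False u True by (metis zero_less_nat_eq)
        next
          case neg: False
          have "K #> (u [^] (-1::int)) = c [^]\<^bsub>?Q\<^esub> (n * (-1))"
            using hp[OF u, of "-1"] n c(1) by (simp only: h.H.int_pow_pow)
          then have "K #> (u [^] (-1::int)) = c [^]\<^bsub>?Q\<^esub> int (nat (- n))" using neg by simp
          moreover have "u [^] (-1::int) \<in> U" by (rule subgroup_int_pow_closed[OF U(1) u])
          moreover have "0 < nat (- n)" using neg \<open>n \<noteq> 0\<close> by simp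
          ultimately show False using False by blast
        qed
      qed
      then show "u \<in> K" using memK[OF u] n by simp
    qed
    then have "U = generate G S" using S(3) by auto
    then show ?thesis using S by blast
  next
    case True
    define d :: nat where "d = (LEAST d. 0 < d \<and> (\<exists>u \<in> U. K #> u = c [^]\<^bsub>?Q\<^esub> int d))"
    have d: "0 < d" "\<exists>u \<in> U. K #> u = c [^]\<^bsub>?Q\<^esub> int d"
      using LeastI_ex[OF True] by (auto simp: d_def)
    then obtain w where w: "w \<in> U" "K #> w = c [^]\<^bsub>?Q\<^esub> int d" by auto
    have least: "\<not> (0 < e \<and> (\<exists>u \<in> U. K #> u = c [^]\<^bsub>?Q\<^esub> int e))" if "e < d" for e
      using not_less_Least that unfolding d_def by blast
    have insc: "insert w S \<subseteq> carrier G" using S(2) Uc[OF w(1)] by auto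
    have sg: "subgroup (generate G (insert w S)) G" by (rule generate_is_subgroup[OF insc])
    have "U \<subseteq> generate G (insert w S)"
    proof
      fix u assume u: "u \<in> U"
      obtain n :: int where n: "K #> u = c [^]\<^bsub>?Q\<^esub> n" using deg[OF u] by auto
      define q where "q = n div int d"
      \<comment> \<open>Division with remainder: the coset of \<open>v\<close> has exponent
        \<open>n mod int d\<close>, which minimality of \<open>d\<close> forces to be 0, so
        \<open>v\<close> lies in \<open>U \<inter> K\<close>.\<close>
      define v where "v = u \<otimes> w [^] (- q)"
      have wq: "w [^] i \<in> U" for i :: int by (rule subgroup_int_pow_closed[OF U(1) w(1)])
      have v: "v \<in> U" unfolding v_def by (rule subgroup.m_closed[OF U(1) u wq])
      have "K #> v = c [^]\<^bsub>?Q\<^esub> n \<otimes>\<^bsub>?Q\<^esub> (c [^]\<^bsub>?Q\<^esub> int d) [^]\<^bsub>?Q\<^esub> (- q)"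
        unfolding v_def hm[OF u wq] hp[OF w(1)] n w(2) ..
      also have "\<dots> = c [^]\<^bsub>?Q\<^esub> (n + int d * (- q))"
        using c(1) by (simp only: h.H.int_pow_pow h.H.int_pow_mult)
      also have "n + int d * (- q) = n mod int d"
        by (simp add: q_def minus_mult_div_eq_mod)
      finally have kv: "K #> v = c [^]\<^bsub>?Q\<^esub> (n mod int d)" .
      have "n mod int d = 0"
      proof (rule ccontr)
        assume "n mod int d \<noteq> 0"
        then have "0 < nat (n mod int d)" "nat (n mod int d) < d"
          using d(1) pos_mod_sign[of "int d" n] pos_mod_bound[of "int d" n]
          by (auto simp: nat_less_iff simp del: pos_mod_sign pos_mod_bound)
        moreover have "K #> v = c [^]\<^bsub>?Q\<^esub> int (nat (n mod int d))" using kv d(1) by simp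
        ultimately show False using least v by blast
      qed
      then have "v \<in> generate G S" using memK[OF v] kv v S(3) by auto
      then have vg: "v \<in> generate G (insert w S)" using mono_generate[of S "insert w S"] by auto
      have wg: "w [^] q \<in> generate G (insert w S)"
        by (rule subgroup_int_pow_closed[OF sg]) (auto intro: generate.incl)
      have "u = v \<otimes> w [^] q"
        using Uc[OF u] Uc[OF w(1)] by (simp add: v_def m_assoc int_pow_neg)
      then show "u \<in> generate G (insert w S)" using subgroup.m_closed[OF sg vg wg] by simp
    qed
    moreover have "S \<subseteq> U" using S(3) generate.incl[of _ S G] by blast
    then have "generate G (insert w S) \<subseteq> U" using w(1) by (intro generate_subgroup_incl[OF _ U(1)]) auto
    ultimately show ?thesis using S(1) insc by (intro exI[of _ "insert w S"]) auto
  qed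
qed

lemma polycyclic_seq_subgroup_fg:
  "polycyclic_seq G H \<Longrightarrow> subgroup U G \<Longrightarrow> U \<subseteq> H \<Longrightarrow>
     \<exists>S. finite S \<and> S \<subseteq> carrier G \<and> U = generate G S"
proof (induction arbitrary: U rule: polycyclic_seq.induct)
  case unity
  then have "U = {\<one>}" using subgroup.one_closed by blast
  then show ?case using generate_empty by (intro exI[of _ "{}"]) auto
next
  case (extension K H)
  have sK: "subgroup K G"
    using incl_subgroup[OF extension(3) normal_imp_subgroup[OF extension(2)]] .
  obtain S where "finite S" "S \<subseteq> carrier G" "U \<inter> K = generate G S"
    using extension.IH[of "U \<inter> K"] subgroups_Inter_pair[OF extension.prems(1) sK] by auto
  then show ?case
    using cyclic_extension_subgroup_fg[OF extension(2-4) extension.prems] by blast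
qed

lemma polycyclic_by_finite_imp_fg:
  assumes "polycyclic_by_finite G"
  shows "all_subgroups_fg G"
  unfolding all_subgroups_fg_def
proof (intro allI impI)
  fix U assume U: "subgroup U G"
  obtain N where N: "N \<lhd> G" "polycyclic (G\<lparr>carrier := N\<rparr>)" "finite (rcosets N)"
    using assms by (auto simp: polycyclic_by_finite_def)
  have sN: "subgroup N G" using N normal_imp_subgroup by auto
  interpret N: group "G\<lparr>carrier := N\<rparr>" using subgroup_imp_group[OF sN] .
  have sUN: "subgroup (U \<inter> N) G" using subgroups_Inter_pair[OF U sN] .
  have "subgroup (U \<inter> N) (G\<lparr>carrier := N\<rparr>)" using subgroup_incl[OF sUN sN] by auto
  then obtain S where S: "finite S" "S \<subseteq> N" "U \<inter> N = generate (G\<lparr>carrier := N\<rparr>) S"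
    using N.polycyclic_seq_subgroup_fg[of N "U \<inter> N"] N(2) by (auto simp: polycyclic_def)
  have UN: "U \<inter> N = generate G S" using S generate_consistent[OF S(2) sN] by simp
  have "finite_mod G (U \<inter> N) U"
  proof (rule finite_mod_fibres[OF sUN subgroup.subset[OF U], of "\<lambda>g. N #> g"])
    have "(\<lambda>g. N #> g) ` U \<subseteq> rcosets N"
      using subgroup.subset[OF U] by (auto simp: RCOSETS_def)
    then show "finite ((\<lambda>g. N #> g) ` U)" using N(3) finite_subset by blast
    fix g g' assume g: "g \<in> U" "g' \<in> U" "N #> g = N #> g'"
    then have "g \<otimes> inv g' \<in> N"
      using rcos_self[OF _ sN, of g] subgroup.rcos_module_imp[OF sN is_group, of g' g] subgroup.mem_carrier[OF U]
      by auto
    then show "g \<otimes> inv g' \<in> U \<inter> N"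
      using g subgroup.m_closed[OF U] subgroup.m_inv_closed[OF U] by auto
  qed
  then obtain F where F: "finite F" "F \<subseteq> carrier G" "U \<subseteq> (U \<inter> N) <#> F"
    by (auto simp: finite_mod_def)
  \<comment> \<open>\<open>F\<close> need not lie in \<open>U\<close>, but any representative used
    for an element of \<open>U\<close> does, since it differs from that element by a factor in
    \<open>U \<inter> N\<close>.\<close>
  let ?S = "S \<union> (F \<inter> U)"
  have Sc: "?S \<subseteq> carrier G" using S(2) F(2) subgroup.subset[OF sN] by auto
  have sg: "subgroup (generate G ?S) G" by (rule generate_is_subgroup[OF Sc])
  have "U \<subseteq> generate G ?S"
  proof
    fix u assume u: "u \<in> U"
    then have "u \<in> (U \<inter> N) <#> F" using F(3) by auto
    then obtain n f where nf: "n \<in> U \<inter> N" "f \<in> F" "u = n \<otimes> f" by (auto simp: set_mult_def)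
    have nc: "n \<in> carrier G" "f \<in> carrier G" using nf F(2) subgroup.mem_carrier[OF U] by auto
    have "f = inv n \<otimes> u" using nf(3) nc by (simp add: word_simps)
    then have "f \<in> U" using u nf(1) subgroup.m_closed[OF U] subgroup.m_inv_closed[OF U] by auto
    then have "f \<in> generate G ?S" using nf(2) by (auto intro: generate.incl)
    moreover have "n \<in> generate G ?S" using nf(1) UN mono_generate[of S ?S] by auto
    ultimately show "u \<in> generate G ?S" using nf(3) subgroup.m_closed[OF sg] by auto
  qed
  moreover have "S \<subseteq> U" using UN generate.incl[of _ S G] by blast
  then have "generate G ?S \<subseteq> U" by (intro generate_subgroup_incl[OF _ U]) auto
  ultimately show "\<exists>S. finite S \<and> S \<subseteq> carrier G \<and> U = generate G S"
    using S(1) F(1) Sc by (intro exI[of _ ?S]) auto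
qed

lemma polycyclic_by_finite_imp_virtually_solvable:
  assumes "polycyclic_by_finite G"
  shows "virtually_solvable G"
proof -
  obtain N where N: "N \<lhd> G" "polycyclic (G\<lparr>carrier := N\<rparr>)" "finite (rcosets N)"
    using assms by (auto simp: polycyclic_by_finite_def)
  have sN: "subgroup N G" using N normal_imp_subgroup by auto
  interpret N: group "G\<lparr>carrier := N\<rparr>" using subgroup_imp_group[OF sN] .
  obtain n where n: "(derived (G\<lparr>carrier := N\<rparr>) ^^ n) N = {\<one>}"
    using N.solvable_imp_trivial_derived_seq[OF N.polycyclic_seq_imp_solvable_seq, of N] N(2)
    by (auto simp: polycyclic_def)
  have "(derived (G\<lparr>carrier := N\<rparr>) ^^ k) N = (derived G ^^ k) N" for k
  proof (induction k)
    case (Suc k)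
    have "(derived G ^^ k) N \<subseteq> N" using N.exp_of_derived_in_carrier[of N k] Suc by simp
    then show ?case using Suc derived_consistent[OF _ sN] by simp
  qed simp
  then show ?thesis
    using N finite_rcosets_imp_finite_mod[OF sN N(3)] n unfolding virtually_solvable_def by metis
qed

end

section \<open>Consequences of finite generation and a finite derived subgroup\<close>

lemma (in comm_group) polycyclic_seq_generate:
  assumes "finite S" "S \<subseteq> carrier G"
  shows "polycyclic_seq G (generate G S)"
  using assms
proof (induction S rule: finite_induct)
  case empty
  then show ?case using generate_empty polycyclic_seq.unity by simp
next
  case (insert x S)
  let ?K = "generate G S" and ?H = "generate G (insert x S)"
  have sK: "subgroup ?K G" and sH: "subgroup ?H G" using generate_is_subgroup insert by auto
  have KH: "?K \<subseteq> ?H" by (rule mono_generate) auto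
  interpret H: comm_group "G\<lparr>carrier := ?H\<rparr>"
    by (rule subgroup_comm_group[OF sH]) (use m_comm subgroup.mem_carrier[OF sH] in auto)
  have KN: "?K \<lhd> G\<lparr>carrier := ?H\<rparr>"
    by (rule H.subgroup_imp_normal[OF subgroup_incl[OF sK sH KH]])
  let ?Q = "(G\<lparr>carrier := ?H\<rparr>) Mod ?K"
  interpret h: group_hom "G\<lparr>carrier := ?H\<rparr>" ?Q "\<lambda>x. ?K #> x"
    using H.FactGroup_group_hom[OF KN] by simp
  have xH: "x \<in> ?H" by (auto intro: generate.incl)
  have xc: "x \<in> carrier G" and Sc: "S \<subseteq> carrier G" using insert by auto
  have hp: "?K #> (x [^] n) = (?K #> x) [^]\<^bsub>?Q\<^esub> (n::int)" for n
    using h.hom_int_pow[of x n] int_pow_consistent[OF sH xH, of n] xH by auto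
  \<comment> \<open>Modulo \<open>?K\<close> every element is a power of the newly added generator,
    so the factor is cyclic.\<close>
  have "A \<in> range (\<lambda>n::int. (?K #> x) [^]\<^bsub>?Q\<^esub> n)" if "A \<in> carrier ?Q" for A
  proof -
    have "A \<in> (\<lambda>a. ?K #> a) ` ?H" using that by (simp add: carrier_FactGroup)
    then obtain a where a: "a \<in> ?H" "A = ?K #> a" by auto
    obtain k :: int and y where ky: "y \<in> ?K" "a = x [^] k \<otimes> y"
      using generate_insert_decomp[OF xc Sc a(1)] by auto
    have yc: "y \<in> carrier G" using subgroup.mem_carrier[OF sK ky(1)] .
    have "a \<in> ?K #> (x [^] k)"
      using ky xc yc m_comm[of "x [^] k" y] by (auto simp: r_coset_def)
    then have "?K #> (x [^] k) = ?K #> a" by (rule repr_independence[OF _ _ sK]) (use xc in simp)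
    then show ?thesis using a(2) hp by auto
  qed
  moreover have "?K #> x \<in> carrier ?Q" using h.hom_closed[of x] xH by simp
  ultimately have "cyclic_group ?Q"
    using h.H.cyclic_group h.H.int_pow_closed by blast
  then show ?case
    using polycyclic_seq.extension[OF _ KN sH] insert by auto
qed

lemma (in group) derived_quotient_polycyclic:
  assumes "finite S" "S \<subseteq> carrier G" "carrier G = generate G S"
  shows "polycyclic (G Mod derived G (carrier G))"
proof -
  let ?D = "derived G (carrier G)"
  interpret Q: comm_group "G Mod ?D" by (rule derived_quot_is_comm_group)
  interpret h: group_hom G "G Mod ?D" "\<lambda>x. ?D #> x"
    by (rule FactGroup_group_hom[OF derived_self_is_normal])
  have "carrier (G Mod ?D) = generate (G Mod ?D) ((\<lambda>x. ?D #> x) ` S)"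
    using h.generate_img[OF assms(2)] assms(3) by (simp add: carrier_FactGroup)
  moreover have "polycyclic_seq (G Mod ?D) (generate (G Mod ?D) ((\<lambda>x. ?D #> x) ` S))"
    by (rule Q.polycyclic_seq_generate) (use assms h.hom_closed in auto)
  ultimately show ?thesis using Q.is_group by (simp add: polycyclic_def)
qed

text \<open>The intersection of \<open>U\<close> with the centre is abelian and normal in
  \<open>U\<close>. Its index is finite: modulo the centre an element is determined by its
  commutators with the finitely many generators, and these lie in the finite derived
  subgroup.\<close>

lemma (in group) subgroup_nilpotent_by_finite:
  assumes S: "finite S" "S \<subseteq> carrier G" "carrier G = generate G S"
    and fin: "finite (derived G (carrier G))" and U: "subgroup U G"
  shows "nilpotent_by_finite (G\<lparr>carrier := U\<rparr>)"
proof -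
  have Uc: "u \<in> carrier G" if "u \<in> U" for u using subgroup.mem_carrier[OF U that] .
  define Z where "Z = {x \<in> carrier G. \<forall>g \<in> carrier G. cmtr G x g \<in> {\<one>}}"
  have ZN: "Z \<lhd> G" unfolding Z_def by (rule relative_center_normal[OF one_is_normal normal_self])
  have sZ: "subgroup Z G" using ZN normal_imp_subgroup by auto
  have ZI: "x \<in> Z" if x: "x \<in> carrier G" and s: "\<And>s. s \<in> S \<Longrightarrow> s \<otimes> x = x \<otimes> s" for x
  proof -
    have "g \<otimes> x = x \<otimes> g" if "g \<in> generate G S" for g
      using that
    proof (induction rule: generate.induct)
      case (inv a)
      have ac: "a \<in> carrier G" using inv S(2) by auto
      have "inv a \<otimes> (x \<otimes> a) \<otimes> inv a = inv a \<otimes> (a \<otimes> x) \<otimes> inv a" using s[OF inv] by simp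
      then show ?case using ac x by (simp add: word_simps)
    next
      case (eng a b)
      have ac: "a \<in> carrier G" "b \<in> carrier G" using eng generate_in_carrier[OF S(2)] by auto
      have "a \<otimes> b \<otimes> x = a \<otimes> x \<otimes> b" using eng.IH(2) ac x by (simp add: m_assoc)
      then show ?case using eng.IH(1) ac x by (simp add: m_assoc)
    qed (use x s in auto)
    then show ?thesis using x S(3) cmtr_eq_one_iff by (auto simp: Z_def)
  qed
  let ?N = "U \<inter> Z" and ?U = "G\<lparr>carrier := U\<rparr>"
  have sN: "subgroup ?N G" using subgroups_Inter_pair[OF U sZ] .
  interpret U: group ?U using subgroup_imp_group[OF U] .
  have comm: "x \<otimes> g = g \<otimes> x" if "x \<in> ?N" "g \<in> carrier G" for x g
    using that cmtr_eq_one_iff by (auto simp: Z_def)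
  have NU: "?N \<lhd> ?U"
    by (rule U.central_imp_normal[OF subgroup_incl[OF sN U]]) (use comm Uc in auto)
  interpret N: group "G\<lparr>carrier := ?N\<rparr>" using subgroup_imp_group[OF sN] .
  have "cmtr (G\<lparr>carrier := ?N\<rparr>) x g = \<one>" if "x \<in> ?N" "g \<in> ?N" for x g
    using N.cmtr_eq_one_iff[of x g] comm[of x g] that Uc by auto
  then have "upper_central (G\<lparr>carrier := ?N\<rparr>) {\<one>\<^bsub>G\<lparr>carrier := ?N\<rparr>\<^esub>} 1 = carrier (G\<lparr>carrier := ?N\<rparr>)"
    by auto
  then have "nilpotent_group (G\<lparr>carrier := ?N\<rparr>)" using N.nilpotent_iff_upper_central by blast
  moreover have "finite_mod G ?N U"
  proof (rule finite_mod_fibres[OF sN subgroup.subset[OF U]])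
    \<comment> \<open>With \<open>inv g\<close> in place of \<open>g\<close>, equal values say that
      \<open>g \<otimes> inv g'\<close> commutes with every generator, as the right coset condition
      requires.\<close>
    let ?f = "\<lambda>g. \<lambda>s\<in>S. cmtr G s (inv g)"
    have "?f g \<in> S \<rightarrow>\<^sub>E derived G (carrier G)" if "g \<in> U" for g
      unfolding restrict_PiE_iff
      using cmtr_mem_derived[of _ "carrier G" "inv g"] S(2) Uc[OF that] by auto
    then have "?f ` U \<subseteq> S \<rightarrow>\<^sub>E derived G (carrier G)" by blast
    then show "finite (?f ` U)" using finite_PiE[OF S(1), of "\<lambda>_. derived G (carrier G)"] fin finite_subset by auto
    fix g g' assume g: "g \<in> U" "g' \<in> U" and eq: "?f g = ?f g'"
    have gc: "g \<in> carrier G" "g' \<in> carrier G" using g Uc by auto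
    have "s \<otimes> (g \<otimes> inv g') = (g \<otimes> inv g') \<otimes> s" if s: "s \<in> S" for s
    proof -
      have sc: "s \<in> carrier G" using s S(2) by auto
      have "cmtr G s (inv g) = cmtr G s (inv g')" using fun_cong[OF eq, of s] s by simp
      then have "g \<otimes> (inv s \<otimes> cmtr G s (inv g)) \<otimes> inv g' \<otimes> s = g \<otimes> (inv s \<otimes> cmtr G s (inv g')) \<otimes> inv g' \<otimes> s"
        by simp
      then have "inv s \<otimes> g \<otimes> inv g' \<otimes> s = g \<otimes> inv g'" using sc gc by (simp add: cmtr_def word_simps)
      then have "s \<otimes> (inv s \<otimes> g \<otimes> inv g' \<otimes> s) = s \<otimes> (g \<otimes> inv g')" by simp
      then show ?thesis using sc gc by (simp add: word_simps)
    qed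
    then show "g \<otimes> inv g' \<in> ?N"
      using ZI gc g subgroup.m_closed[OF U] subgroup.m_inv_closed[OF U] by auto
  qed
  then have "finite (rcosets\<^bsub>?U\<^esub> ?N)" by (rule finite_mod_imp_finite_rcosets[OF _ sN])
  ultimately show ?thesis using NU unfolding nilpotent_by_finite_def by auto
qed

theorem mainTheorem6:
  fixes G :: "('a, 'b) monoid_scheme"
  assumes "group G"
    and "\<not> nilpotent_group G"
    and "meta_nil_hamiltonian G"
    and "polycyclic_by_finite G"
  shows "finite (derived G (carrier G)) \<and> finite_by_polycyclic G \<and>
         nilpotent_by_finite (G\<lparr>carrier := fitting_subgroup G\<rparr>)"
proof -
  interpret group G by fact
  have fg: "all_subgroups_fg G" using polycyclic_by_finite_imp_fg assms by auto
  then obtain S where S: "finite S" "S \<subseteq> carrier G" "carrier G = generate G S"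
    using subgroup_self unfolding all_subgroups_fg_def by blast
  have fin: "finite (derived G (carrier G))"
    using meta_nil_hamiltonian_derived_finite[OF assms(3) fg polycyclic_by_finite_imp_virtually_solvable] assms by auto
  moreover have "finite_by_polycyclic G"
    using fin derived_quotient_polycyclic[OF S] derived_self_is_normal
    unfolding finite_by_polycyclic_def by blast
  moreover have "subgroup (fitting_subgroup G) G"
    unfolding fitting_subgroup_def by (rule generate_is_subgroup) (auto simp: normal_mem_carrier)
  then have "nilpotent_by_finite (G\<lparr>carrier := fitting_subgroup G\<rparr>)"
    by (rule subgroup_nilpotent_by_finite[OF S fin])
  ultimately show ?thesis by blast
qed

end
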